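(* Let $\zeta_2:=\arccos\left(-\frac13\right)$. There exists a correspondence between $\mathbb{S}^2$ and $\mathbb{S}^3$ with distortion at most $\zeta_2$. In particular, $d_{\mathrm{GH}}(\mathbb{S}^2,\mathbb{S}^3)=\frac{1}{2}\zeta_2$.
   Context: For an integer $m\ge 0$, $\mathbb{S}^m=\{x\in\mathbb{R}^{m+1}:\|x\|=1\}$ is the unit sphere with the geodesic distance $d_{\mathbb{S}^m}(x,x')=\arccos\langle x,x'\rangle$. A correspondence between metric spaces $X$ and $Y$ is a relation $R\subseteq X\times Y$ whose projections to $X$ and to $Y$ are both surjective; its distortion is $\operatorname{dis}(R)=\sup_{(x,y),(x',y')\in R}|d_X(x,x')-d_Y(y,y')|$. The Gromov-Hausdorff distance between bounded metric spaces is $d_{\mathrm{GH}}(X,Y)=\inf d_{\mathrm{H}}(f(X),g(Y))$ over all metric spaces $Z$ and isometric embeddings $f:X\to Z$, $g:Y\to Z$ ($d_{\mathrm H}$ the Hausdorff distance); equivalently $d_{\mathrm{GH}}(X,Y)=\frac12\inf_R\operatorname{dis}(R)$ over all correspondences $R$. *)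

theory Defs
  imports "HOL-Analysis.Analysis"
begin

section \<open>Unit spheres with the geodesic distance\<close>

text \<open>
  The sphere of dimension \<open>m\<close> is the unit sphere of \<open>real ^ 'n\<close> with \<open>CARD('n) = m + 1\<close>.
  A distance function of type \<open>'a metric\<close> has to be nonnegative and symmetric on the
  whole type, while \<^const>\<open>arccos\<close> is unspecified outside \<open>[-1, 1]\<close>; hence the guard,
  which does not affect the distance of points of the sphere.
\<close>

definition geodesic_sphere :: "(real ^ 'n) metric" where
  "geodesic_sphere =
     metric (sphere 0 1,
             \<lambda>x y. if x \<in> sphere 0 1 \<and> y \<in> sphere 0 1 then arccos (x \<bullet> y) else 0)"

lemma inner_sphere_bounds:
  fixes x y :: "'a::real_inner"
  assumes "norm x = 1" "norm y = 1"
  shows "-1 \<le> x \<bullet> y" "x \<bullet> y \<le> 1"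
  using Cauchy_Schwarz_ineq2[of x y] assms by (auto simp: abs_le_iff)

lemma arccos_inner_triangle:
  fixes x y z :: "'a::real_inner"
  assumes n: "norm x = 1" "norm y = 1" "norm z = 1"
  shows "arccos (x \<bullet> z) \<le> arccos (x \<bullet> y) + arccos (y \<bullet> z)"
proof (cases "arccos (x \<bullet> y) + arccos (y \<bullet> z) \<le> pi")
  case False
  then show ?thesis
    using arccos_ubound[OF inner_sphere_bounds[OF n(1,3)]] by linarith
next
  case True
  let ?a = "x \<bullet> y" and ?b = "y \<bullet> z"
  have a: "-1 \<le> ?a" "?a \<le> 1" and b: "-1 \<le> ?b" "?b \<le> 1"
    using inner_sphere_bounds n by blast+
  have sq: "x \<bullet> x = 1" "y \<bullet> y = 1" "z \<bullet> z = 1"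
    using n by (simp_all add: dot_square_norm)
  let ?x = "x - ?a *\<^sub>R y" and ?z = "z - ?b *\<^sub>R y"
  have nx: "norm ?x = sqrt (1 - ?a\<^sup>2)"
    by (simp add: norm_eq_sqrt_inner inner_diff_left inner_diff_right sq inner_commute[of y x]
        power2_eq_square)
  have nz: "norm ?z = sqrt (1 - ?b\<^sup>2)"
    by (simp add: norm_eq_sqrt_inner inner_diff_left inner_diff_right sq inner_commute[of z y]
        power2_eq_square)
  have eq: "?x \<bullet> ?z = x \<bullet> z - ?a * ?b"
    by (simp add: inner_diff_left inner_diff_right sq)
  have "\<bar>?x \<bullet> ?z\<bar> \<le> sqrt (1 - ?a\<^sup>2) * sqrt (1 - ?b\<^sup>2)"
    using Cauchy_Schwarz_ineq2[of ?x ?z] unfolding nx nz .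
  then have le: "?a * ?b - sqrt (1 - ?a\<^sup>2) * sqrt (1 - ?b\<^sup>2) \<le> x \<bullet> z"
    unfolding eq by (simp add: abs_le_iff)
  have "cos (arccos ?a + arccos ?b) \<le> x \<bullet> z"
    using le a b by (simp add: cos_add sin_arccos)
  then have "arccos (x \<bullet> z) \<le> arccos (cos (arccos ?a + arccos ?b))"
    using inner_sphere_bounds[OF n(1,3)] by (intro arccos_le_arccos) auto
  also have "\<dots> = arccos ?a + arccos ?b"
    using True arccos_lbound[OF a] arccos_lbound[OF b] by (intro arccos_cos) auto
  finally show ?thesis .
qed

lemma Metric_space_geodesic:
  "Metric_space (sphere (0 :: 'a::real_inner) 1)
     (\<lambda>x y. if x \<in> sphere 0 1 \<and> y \<in> sphere 0 1 then arccos (x \<bullet> y) else 0)"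
proof
  fix x y :: 'a
  show "0 \<le> (if x \<in> sphere 0 1 \<and> y \<in> sphere 0 1 then arccos (x \<bullet> y) else 0)"
    using arccos_lbound inner_sphere_bounds[of x y] by auto
  show "(if x \<in> sphere 0 1 \<and> y \<in> sphere 0 1 then arccos (x \<bullet> y) else 0) =
        (if y \<in> sphere 0 1 \<and> x \<in> sphere 0 1 then arccos (y \<bullet> x) else 0)"
    by (simp add: inner_commute)
next
  fix x y :: 'a
  assume "x \<in> sphere 0 1" "y \<in> sphere 0 1"
  then have n: "norm x = 1" "norm y = 1" by auto
  have "arccos (x \<bullet> y) = 0 \<longleftrightarrow> x = y"
  proof
    assume "arccos (x \<bullet> y) = 0"
    then have "x \<bullet> y = 1"
      using cos_arccos[OF inner_sphere_bounds[OF n]] by simp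
    moreover have "(x - y) \<bullet> (x - y) = (norm x)\<^sup>2 - 2 * (x \<bullet> y) + (norm y)\<^sup>2"
      by (simp add: inner_diff_left inner_diff_right power2_norm_eq_inner inner_commute[of y x])
    ultimately have "(x - y) \<bullet> (x - y) = 0"
      using n by simp
    then show "x = y" by simp
  next
    assume "x = y"
    then show "arccos (x \<bullet> y) = 0"
      using n by (simp add: dot_square_norm)
  qed
  then show "((if x \<in> sphere 0 1 \<and> y \<in> sphere 0 1 then arccos (x \<bullet> y) else 0) = 0) = (x = y)"
    using n by simp
next
  fix x y z :: 'a
  assume "x \<in> sphere 0 1" "y \<in> sphere 0 1" "z \<in> sphere 0 1"
  then show "(if x \<in> sphere 0 1 \<and> z \<in> sphere 0 1 then arccos (x \<bullet> z) else 0)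
    \<le> (if x \<in> sphere 0 1 \<and> y \<in> sphere 0 1 then arccos (x \<bullet> y) else 0) +
      (if y \<in> sphere 0 1 \<and> z \<in> sphere 0 1 then arccos (y \<bullet> z) else 0)"
    using arccos_inner_triangle[of x y z] by simp
qed

lemma mspace_geodesic_sphere [simp]: "mspace geodesic_sphere = sphere 0 1"
  unfolding geodesic_sphere_def
  by (rule Metric_space.mspace_metric[OF Metric_space_geodesic])

lemma mdist_geodesic_sphere:
  assumes "x \<in> sphere 0 1" "y \<in> sphere 0 1"
  shows "mdist geodesic_sphere x y = arccos (x \<bullet> y)"
  using assms unfolding geodesic_sphere_def
  by (subst Metric_space.mdist_metric[OF Metric_space_geodesic]) simp

abbreviation S2 :: "(real ^ 3) metric" where "S2 \<equiv> geodesic_sphere"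

abbreviation S3 :: "(real ^ 4) metric" where "S3 \<equiv> geodesic_sphere"


section \<open>Correspondences and distortion\<close>

definition correspondence :: "'a metric \<Rightarrow> 'b metric \<Rightarrow> ('a \<times> 'b) set \<Rightarrow> bool" where
  "correspondence X Y R \<longleftrightarrow>
     R \<subseteq> mspace X \<times> mspace Y \<and> fst ` R = mspace X \<and> snd ` R = mspace Y"

text \<open>
  The suprema and infima below are taken in the reals. They have their usual meaning for
  nonempty bounded metric spaces, which are the only spaces these notions are applied to.
\<close>

definition distortion :: "'a metric \<Rightarrow> 'b metric \<Rightarrow> ('a \<times> 'b) set \<Rightarrow> real" where
  "distortion X Y R =
     Sup {\<bar>mdist X x x' - mdist Y y y'\<bar> | x y x' y'. (x, y) \<in> R \<and> (x', y') \<in> R}"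


section \<open>Hausdorff and Gromov-Hausdorff distance\<close>

definition hausdorff_distance :: "'a metric \<Rightarrow> 'a set \<Rightarrow> 'a set \<Rightarrow> real" where
  "hausdorff_distance Z A B =
     max (SUP a\<in>A. INF b\<in>B. mdist Z a b) (SUP b\<in>B. INF a\<in>A. mdist Z a b)"

definition isometric_embedding :: "'a metric \<Rightarrow> 'b metric \<Rightarrow> ('a \<Rightarrow> 'b) \<Rightarrow> bool" where
  "isometric_embedding X Z f \<longleftrightarrow>
     f \<in> mspace X \<rightarrow> mspace Z \<and>
     (\<forall>x\<in>mspace X. \<forall>x'\<in>mspace X. mdist Z (f x) (f x') = mdist X x x')"

text \<open>
  One cannot quantify over the type of points of the ambient space \<open>Z\<close> inside a definition.
  Only the subspace \<open>f(X) \<union> g(Y)\<close> of \<open>Z\<close> matters, and it is in bijection with a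
  subset of \<open>'a + 'b\<close>, so it suffices that \<open>Z\<close> ranges over all metric spaces carried by
  subsets of this type; see lemma \<open>ambient_space_universal\<close>.
\<close>

definition gromov_hausdorff :: "'a metric \<Rightarrow> 'b metric \<Rightarrow> real" where
  "gromov_hausdorff X Y =
     Inf {hausdorff_distance Z (f ` mspace X) (g ` mspace Y) | (Z :: ('a + 'b) metric) f g.
            isometric_embedding X Z f \<and> isometric_embedding Y Z g}"

lemma ambient_space_universal:
  fixes X :: "'a metric" and Y :: "'b metric" and W :: "'c metric"
  assumes f: "isometric_embedding X W f" and g: "isometric_embedding Y W g"
  shows "\<exists>(Z :: ('a + 'b) metric) f' g'.
           isometric_embedding X Z f' \<and> isometric_embedding Y Z g' \<and>
           hausdorff_distance Z (f' ` mspace X) (g' ` mspace Y) =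
           hausdorff_distance W (f ` mspace X) (g ` mspace Y)"
proof -
  define C where "C = f ` mspace X \<union> g ` mspace Y"
  define h :: "'c \<Rightarrow> 'a + 'b" where
    "h = (\<lambda>w. if w \<in> f ` mspace X then Inl (inv_into (mspace X) f w)
              else Inr (inv_into (mspace Y) g w))"
  define k where "k = inv_into C h"
  define Z where "Z = metric (h ` C, \<lambda>u v. mdist W (k u) (k v))"
  have CW: "C \<subseteq> mspace W"
    using f g by (auto simp: C_def isometric_embedding_def)
  have inj: "inj_on h C"
    by (auto simp: inj_on_def h_def C_def split: if_splits dest: inv_into_injective)
  have kh: "k (h w) = w" if "w \<in> C" for w
    using that inj by (simp add: k_def)
  have MZ: "Metric_space (h ` C) (\<lambda>u v. mdist W (k u) (k v))"
  proof
    fix u v assume "u \<in> h ` C" "v \<in> h ` C"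
    then show "(mdist W (k u) (k v) = 0) = (u = v)"
      using CW kh by (auto simp: subset_iff)
  next
    fix u v w assume "u \<in> h ` C" "v \<in> h ` C" "w \<in> h ` C"
    then show "mdist W (k u) (k w) \<le> mdist W (k u) (k v) + mdist W (k v) (k w)"
      using CW kh by (auto simp: subset_iff intro!: mdist_triangle)
  qed (auto simp: mdist_commute)
  have mZ: "mspace Z = h ` C"
    unfolding Z_def by (rule Metric_space.mspace_metric[OF MZ])
  have dZ: "mdist Z (h u) (h v) = mdist W u v" if "u \<in> C" "v \<in> C" for u v
    unfolding Z_def by (subst Metric_space.mdist_metric[OF MZ]) (simp add: kh that)
  have fC: "f x \<in> C" if "x \<in> mspace X" for x using that by (simp add: C_def)
  have gC: "g y \<in> C" if "y \<in> mspace Y" for y using that by (simp add: C_def)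
  have 1: "isometric_embedding X Z (h \<circ> f)"
    using f fC by (auto simp: isometric_embedding_def mZ dZ)
  have 2: "isometric_embedding Y Z (h \<circ> g)"
    using g gC by (auto simp: isometric_embedding_def mZ dZ)
  have 3: "hausdorff_distance Z ((h \<circ> f) ` mspace X) ((h \<circ> g) ` mspace Y) =
           hausdorff_distance W (f ` mspace X) (g ` mspace Y)"
    unfolding hausdorff_distance_def image_image
    by (intro arg_cong2[where f = max] SUP_cong INF_cong refl) (simp_all add: image_image dZ fC gC)
  show ?thesis using 1 2 3 by blast
qed


definition zeta2 :: real where
  "zeta2 = arccos (- (1 / 3))"

end

theory Submission
  imports Defs
begin

text \<open>
  Both halves of the theorem come from the regular tetrahedron inscribed in the two-dimensional sphere,
  whose vertices are at mutual distance \<open>zeta2\<close>.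

  Lower bound. Four unit vectors of \<open>real ^ 3\<close> at mutual distances less than \<open>zeta2\<close> do not have the
  origin in their convex hull, since the regular tetrahedron is the extreme case
  (\<open>zero_notin_convex_hull_unit_vectors\<close>). A map from the three-dimensional to the two-dimensional sphere
  with distortion less than \<open>zeta2\<close>, discontinuous as it may be, can be made odd and then averaged over
  small neighbourhoods to a continuous odd map into \<open>real ^ 3\<close> without zeros
  (\<open>sphere_map_distortion_ge\<close>). The Borsuk-Ulam theorem forbids this. It is proved here in the
  needed dimension by lifting the map on a hemisphere through the Hopf fibration: the determinant of the
  lifts at antipodal points of the equator is an odd complex function without zeros on the two-dimensional
  sphere (\<open>odd_on_boundary_has_zero\<close>), and this is excluded by taking logarithms.

  Upper bound. View the upper hemisphere of the three-dimensional sphere as lying above its equator, a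
  two-dimensional sphere divided into the four Voronoi cells of the tetrahedron. Low points are paired with
  the point of the equator below them, high points with the vertex of the cell below them, and the
  lower hemisphere is treated antipodally. Sending all points above a cell to its vertex would
  not do, because the cells have diameter greater than \<open>zeta2\<close>. The height of the cut between
  low and high, \<open>min u (1 / sqrt 3)\<close> with \<open>u\<close> the cosine of the distance to the vertex, is chosen such
  that all three kinds of pairs have distortion at most \<open>zeta2\<close> (\<open>band_band_distortion\<close>,
  \<open>cap_cap_distortion\<close>, \<open>band_cap_distortion\<close>). Gluing the two spheres along this
  correspondence with segments of length \<open>zeta2 / 2\<close> realises the Gromov-Hausdorff distance
  (\<open>correspondence_gluing\<close>).
\<close>

section \<open>Spinors and the Borsuk-Ulam theorem\<close>

text \<open>
  For a unit vector \<open>h\<close>, the Hermitian matrix \<open>h \<bullet> \<sigma>\<close> (\<open>\<sigma>\<close> the triple of Pauli matrices)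
  has eigenvalues \<open>1\<close> and \<open>-1\<close>; \<open>transverse h\<close> is its lower left entry, and \<open>spinor h a b\<close>
  says that \<open>(a, b)\<close> lies in the \<open>1\<close>-eigenspace. This eigenspace is a complex line, and
  \<open>h \<mapsto>\<close> (this line) is the standard identification of the sphere with the complex
  projective line: finding a nonzero spinor is lifting \<open>h\<close> through the Hopf fibration. The
  eigenvector equation is spelled out in components, so that no matrix theory intervenes.
\<close>

definition transverse :: "real ^ 3 \<Rightarrow> complex" where
  "transverse h = of_real (h $ 1) + \<i> * of_real (h $ 2)"

definition spinor :: "real ^ 3 \<Rightarrow> complex \<Rightarrow> complex \<Rightarrow> bool" where
  "spinor h a b \<longleftrightarrow>
     of_real (h $ 3) * a + cnj (transverse h) * b = a \<and>
     transverse h * a - of_real (h $ 3) * b = b"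

lemma transverse_add: "transverse (h + k) = transverse h + transverse k"
  by (simp add: transverse_def algebra_simps)

text \<open>
  The diagonal entries of \<open>(h \<bullet> \<sigma>)\<^sup>2 = (h \<bullet> h) 1\<close>.
\<close>

lemma pauli_square: "of_real (h $ 3) * of_real (h $ 3) + cnj (transverse h) * transverse h = of_real (h \<bullet> h)"
  by (simp add: transverse_def inner_vec_def sum_3 complex_eq_iff algebra_simps)

text \<open>
  Apply \<open>h \<bullet> \<sigma>\<close> once more: the square is a scalar matrix, so \<open>h \<bullet> \<sigma>\<close> is invertible unless
  \<open>h = 0\<close>.
\<close>

lemma pauli_injective:
  assumes "of_real (h $ 3) * a + cnj (transverse h) * b = 0"
    and "transverse h * a - of_real (h $ 3) * b = 0"
    and "a \<noteq> 0 \<or> b \<noteq> 0"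
  shows "h = 0"
proof -
  have "of_real (h \<bullet> h) * a =
      of_real (h $ 3) * (of_real (h $ 3) * a + cnj (transverse h) * b) +
      cnj (transverse h) * (transverse h * a - of_real (h $ 3) * b)"
    unfolding pauli_square[symmetric] by (simp add: algebra_simps)
  moreover have "of_real (h \<bullet> h) * b =
      transverse h * (of_real (h $ 3) * a + cnj (transverse h) * b) -
      of_real (h $ 3) * (transverse h * a - of_real (h $ 3) * b)"
    unfolding pauli_square[symmetric] by (simp add: algebra_simps)
  ultimately have "complex_of_real (h \<bullet> h) = 0"
    using assms by auto
  then show ?thesis by simp
qed

lemma spinor_exists:
  assumes "norm h = 1"
  shows "\<exists>a b. (a \<noteq> 0 \<or> b \<noteq> 0) \<and> spinor h a b"
proof (cases "h $ 3 = -1")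
  case True
  have "h \<bullet> h = 1" using assms by (simp add: dot_square_norm)
  then have "(h $ 1)\<^sup>2 + (h $ 2)\<^sup>2 = 0"
    using True by (simp add: inner_vec_def sum_3 power2_eq_square)
  then have "h $ 1 = 0" "h $ 2 = 0" by (simp_all add: sum_power2_eq_zero_iff)
  then have "spinor h 0 1" using True by (simp add: spinor_def transverse_def)
  then show ?thesis by (metis zero_neq_one)
next
  case False
  have 1: "of_real (h $ 3) * of_real (h $ 3) + cnj (transverse h) * transverse h = 1"
    unfolding pauli_square using assms by (simp add: dot_square_norm)
  have "1 + complex_of_real (h $ 3) \<noteq> 0"
    using False by (simp add: complex_eq_iff)
  moreover have "spinor h (1 + of_real (h $ 3)) (transverse h)"
    using 1 by (simp add: spinor_def algebra_simps)
  ultimately show ?thesis by blast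
qed

text \<open>
  The matrix \<open>1 + h \<bullet> \<sigma>\<close> is twice the orthogonal projection onto the \<open>1\<close>-eigenspace, because
  \<open>(h \<bullet> \<sigma>)\<^sup>2 = 1\<close>.
\<close>

lemma spinor_project:
  assumes h: "norm h = 1"
    and a': "a' = a + (of_real (h $ 3) * a + cnj (transverse h) * b)"
    and b': "b' = b + (transverse h * a - of_real (h $ 3) * b)"
  shows "spinor h a' b'"
proof -
  have 1: "of_real (h $ 3) * of_real (h $ 3) + cnj (transverse h) * transverse h = 1"
    unfolding pauli_square using h by (simp add: dot_square_norm)
  have "of_real (h $ 3) * a' + cnj (transverse h) * b' =
     of_real (h $ 3) * a + cnj (transverse h) * b +
     (of_real (h $ 3) * of_real (h $ 3) + cnj (transverse h) * transverse h) * a"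
    unfolding a' b' by (simp add: algebra_simps)
  moreover have "transverse h * a' - of_real (h $ 3) * b' =
     transverse h * a - of_real (h $ 3) * b +
     (of_real (h $ 3) * of_real (h $ 3) + cnj (transverse h) * transverse h) * b"
    unfolding a' b' by (simp add: algebra_simps)
  ultimately show ?thesis
    unfolding spinor_def 1 by (simp add: a' b')
qed

text \<open>
  A spinor of \<open>k\<close> killed by the projection of \<open>h\<close> is annihilated by \<open>(k + h) \<bullet> \<sigma>\<close>, so that
  \<open>h\<close> is the antipode of \<open>k\<close>.
\<close>

lemma spinor_project_nonzero:
  assumes "spinor k a b" "a \<noteq> 0 \<or> b \<noteq> 0" "k + h \<noteq> 0"
  shows "a + (of_real (h $ 3) * a + cnj (transverse h) * b) \<noteq> 0 \<or>
         b + (transverse h * a - of_real (h $ 3) * b) \<noteq> 0"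
proof (rule ccontr)
  assume "\<not> ?thesis"
  then have "of_real ((k + h) $ 3) * a + cnj (transverse (k + h)) * b = 0"
     "transverse (k + h) * a - of_real ((k + h) $ 3) * b = 0"
    using assms(1) unfolding spinor_def transverse_add
    by (auto simp: algebra_simps)
  from pauli_injective[OF this assms(2)] assms(3) show False by simp
qed

text \<open>
  Lifting through the Hopf fibration over a ball, done by hand. The lift exists over the
  constant map with value \<open>H 0\<close>. Shrinking the ball to its centre in small steps \<open>t k\<close>, two
  consecutive maps \<open>\<lambda>x. H (t k *\<^sub>R x)\<close> are uniformly close, hence nowhere antipodal, and
  the projection of \<open>spinor_project\<close> transports a lift of one to a lift of the next.
\<close>

proposition spinor_lift:
  fixes H :: "real ^ 'n \<Rightarrow> real ^ 3"
  assumes cont: "continuous_on (cball 0 1) H" and unit: "\<And>x. x \<in> cball 0 1 \<Longrightarrow> norm (H x) = 1"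
  obtains a b where "continuous_on (cball 0 1) a" "continuous_on (cball 0 1) b"
    "\<And>x. x \<in> cball 0 1 \<Longrightarrow> (a x \<noteq> 0 \<or> b x \<noteq> 0) \<and> spinor (H x) (a x) (b x)"
proof -
  have "uniformly_continuous_on (cball 0 1) H"
    using cont by (rule compact_uniformly_continuous) simp
  then obtain d where d: "d > 0"
    "\<And>x y. x \<in> cball 0 1 \<Longrightarrow> y \<in> cball 0 1 \<Longrightarrow> dist y x < d \<Longrightarrow> dist (H y) (H x) < 2"
    unfolding uniformly_continuous_on_def by (metis zero_less_numeral)
  obtain n where n: "inverse (real (Suc n)) < d"
    using d(1) reals_Archimedean by blast
  define t where "t k = real k / real (Suc n)" for k
  have t: "t k *\<^sub>R x \<in> cball 0 1" if "k \<le> Suc n" "x \<in> cball 0 1" for k and x :: "real ^ 'n"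
  proof -
    have "0 \<le> t k" "t k \<le> 1" using that by (simp_all add: t_def)
    then show ?thesis using that by (simp add: mult_le_one)
  qed
  have contH: "continuous_on (cball 0 1) (\<lambda>x. H (t k *\<^sub>R x))" if "k \<le> Suc n" for k
    by (rule continuous_on_compose2[OF cont]) (use t that in \<open>auto intro!: continuous_intros\<close>)
  have "\<exists>a b. continuous_on (cball 0 1) a \<and> continuous_on (cball 0 1) b \<and>
      (\<forall>x\<in>cball 0 1. (a x \<noteq> 0 \<or> b x \<noteq> 0) \<and> spinor (H (t k *\<^sub>R x)) (a x) (b x))"
    if "k \<le> Suc n" for k
    using that
  proof (induction k)
    case 0
    obtain a b where "(a \<noteq> 0 \<or> b \<noteq> 0) \<and> spinor (H 0) a b"
      using spinor_exists[OF unit[of 0]] by auto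
    then show ?case
      by (intro exI[of _ "\<lambda>x. a"] exI[of _ "\<lambda>x. b"]) (simp add: t_def)
  next
    case (Suc k)
    then obtain a b where ab: "continuous_on (cball 0 1) a" "continuous_on (cball 0 1) b"
      and sp: "\<And>x. x \<in> cball 0 1 \<Longrightarrow>
           (a x \<noteq> 0 \<or> b x \<noteq> 0) \<and> spinor (H (t k *\<^sub>R x)) (a x) (b x)"
      by auto
    define h where "h x = H (t (Suc k) *\<^sub>R x)" for x
    have conth: "continuous_on (cball 0 1) h"
      unfolding h_def by (rule contH) (use Suc in simp)
    have conth': "continuous_on (cball 0 1) (\<lambda>x. h x $ i)" for i
      by (intro continuous_on_component conth)
    let ?a = "\<lambda>x. a x + (of_real (h x $ 3) * a x + cnj (transverse (h x)) * b x)"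
    let ?b = "\<lambda>x. b x + (transverse (h x) * a x - of_real (h x $ 3) * b x)"
    have "continuous_on (cball 0 1) ?a" "continuous_on (cball 0 1) ?b"
      unfolding transverse_def by (intro continuous_intros ab conth')+
    moreover have "(?a x \<noteq> 0 \<or> ?b x \<noteq> 0) \<and> spinor (h x) (?a x) (?b x)"
      if x: "x \<in> cball 0 1" for x
    proof
      have nh: "norm (h x) = 1"
        unfolding h_def using t[OF Suc.prems x] by (rule unit)
      show "spinor (h x) (?a x) (?b x)"
        using nh by (rule spinor_project) simp_all
      have "t (Suc k) - t k = inverse (real (Suc n))"
        by (simp add: t_def divide_simps)
      then have "dist (t (Suc k) *\<^sub>R x) (t k *\<^sub>R x) = inverse (real (Suc n)) * norm x"
        by (simp add: dist_norm flip: scaleR_left_diff_distrib)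
      also have "\<dots> \<le> inverse (real (Suc n)) * 1"
        using x by (intro mult_left_mono) auto
      also have "\<dots> < d" using n by simp
      finally have "dist (h x) (H (t k *\<^sub>R x)) < 2"
        unfolding h_def using Suc.prems x by (intro d t) simp_all
      moreover have "dist (h x) (H (t k *\<^sub>R x)) = 2" if "H (t k *\<^sub>R x) + h x = 0"
      proof -
        have "H (t k *\<^sub>R x) = - h x" using that by (simp add: eq_neg_iff_add_eq_0)
        then show ?thesis using nh by (simp add: dist_norm flip: scaleR_2)
      qed
      ultimately have "H (t k *\<^sub>R x) + h x \<noteq> 0" by linarith
      then show "?a x \<noteq> 0 \<or> ?b x \<noteq> 0"
        using sp[OF x] by (intro spinor_project_nonzero[of "H (t k *\<^sub>R x)"]) auto
    qed
    ultimately show ?case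
      unfolding h_def by blast
  qed
  from this[of "Suc n"] show ?thesis
    using that by (auto simp: t_def)
qed

text \<open>
  The Borsuk-Ulam theorem in dimension two. Without a zero the map has a continuous logarithm
  \<open>g\<close>; the function \<open>Im (g (- x) - g x)\<close> is continuous and odd on a connected set, so it vanishes somewhere,
  and there \<open>w (- x) / w x\<close> is a positive real instead of \<open>-1\<close>.
\<close>

lemma odd_complex_map_on_sphere_has_zero:
  fixes w :: "real ^ 3 \<Rightarrow> complex"
  assumes cont: "continuous_on (sphere 0 1) w"
    and odd: "\<And>x. x \<in> sphere 0 1 \<Longrightarrow> w (- x) = - w x"
  shows "\<exists>x\<in>sphere 0 1. w x = 0"
proof (rule ccontr)
  assume "\<not> ?thesis"
  then have nz: "w \<in> sphere 0 1 \<rightarrow> - {0}" by auto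
  have "Borsukian (sphere (0 :: real ^ 3) 1)" by (rule Borsukian_sphere) simp
  then obtain g where g: "continuous_on (sphere 0 1) g"
    and wg: "\<And>x. x \<in> sphere 0 1 \<Longrightarrow> w x = exp (g x)"
    using cont nz unfolding Borsukian_continuous_logarithm by blast
  define k where "k x = Im (g (- x) - g x)" for x
  have contk: "continuous_on (sphere 0 1) k"
    unfolding k_def
    by (intro continuous_intros g continuous_on_compose2[OF g]) auto
  have conn: "connected (k ` sphere 0 1)"
    by (intro connected_continuous_image contk connected_sphere) simp
  obtain e :: "real ^ 3" where e: "e \<in> sphere 0 1"
    using vector_choose_size[of 1] by auto
  have ke: "k (- e) = - k e" by (simp add: k_def)
  have e': "k e \<in> k ` sphere 0 1" "- k e \<in> k ` sphere 0 1"
    using e ke by (auto intro!: image_eqI[of _ k "- e"])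
  have "0 \<in> k ` sphere 0 1"
  proof (cases "k e \<le> 0")
    case True
    then show ?thesis using connectedD_interval[OF conn e'] by simp
  next
    case False
    then show ?thesis using connectedD_interval[OF conn e'(2,1)] by simp
  qed
  then obtain x where x: "x \<in> sphere 0 1" "k x = 0" by force
  have "exp (g (- x) - g x) = w (- x) / w x"
    using x by (simp add: exp_diff wg)
  also have "\<dots> = -1"
    using odd[OF x(1)] nz x by (simp add: Pi_iff)
  finally have "Re (exp (g (- x) - g x)) = -1" by simp
  moreover have "Re (exp (g (- x) - g x)) = exp (Re (g (- x) - g x))"
    using x(2) by (simp add: Re_exp k_def)
  ultimately show False
    using exp_gt_zero[of "Re (g (- x) - g x)"] by linarith
qed

text \<open>
  Spinors of \<open>h\<close> and of \<open>- h\<close> are eigenvectors of \<open>h \<bullet> \<sigma>\<close> for the distinct eigenvalues \<open>1\<close>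
  and \<open>-1\<close>.
\<close>

lemma spinors_antipodal_independent:
  assumes "spinor h a b" "a \<noteq> 0 \<or> b \<noteq> 0" "spinor (- h) c d" "c \<noteq> 0 \<or> d \<noteq> 0"
  shows "a * d - b * c \<noteq> 0"
proof
  assume det: "a * d - b * c = 0"
  have "\<exists>m. c = m * a \<and> d = m * b"
  proof (cases "a = 0")
    case True
    then show ?thesis using assms(2) det by (intro exI[of _ "d / b"]) auto
  next
    case False
    then show ?thesis using det by (intro exI[of _ "c / a"]) (simp add: field_simps)
  qed
  then obtain m where m: "c = m * a" "d = m * b" by blast
  have fix_ab: "of_real (h $ 3) * a + cnj (transverse h) * b = a"
    "transverse h * a - of_real (h $ 3) * b = b"
    using assms(1) unfolding spinor_def by blast+
  have "of_real (h $ 3) * c + cnj (transverse h) * d = m * (of_real (h $ 3) * a + cnj (transverse h) * b)"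
    "transverse h * c - of_real (h $ 3) * d = m * (transverse h * a - of_real (h $ 3) * b)"
    by (simp_all add: m algebra_simps)
  then have "of_real (h $ 3) * c + cnj (transverse h) * d = c"
    "transverse h * c - of_real (h $ 3) * d = d"
    unfolding fix_ab m by blast+
  moreover have "- (of_real (h $ 3) * c + cnj (transverse h) * d) = c"
    "- (transverse h * c - of_real (h $ 3) * d) = d"
    using assms(3) by (simp_all add: spinor_def transverse_def algebra_simps)
  ultimately have "- c = c" "- d = d" by metis+
  then show False using assms(4) by simp
qed

text \<open>
  The Borsuk-Ulam theorem in dimension three, reduced to dimension two. Normalise a nowhere
  vanishing \<open>F\<close> and lift it to a spinor field \<open>(a, b)\<close> on the ball. On the boundary, the values
  at \<open>x\<close> and \<open>- x\<close> are spinors of antipodal vectors, so their determinant \<open>w x\<close> is nonzero;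
  being alternating, it is an odd function of \<open>x\<close>.
\<close>

theorem odd_on_boundary_has_zero:
  fixes F :: "real ^ 3 \<Rightarrow> real ^ 3"
  assumes cont: "continuous_on (cball 0 1) F"
    and odd: "\<And>x. x \<in> sphere 0 1 \<Longrightarrow> F (- x) = - F x"
  shows "\<exists>x\<in>cball 0 1. F x = 0"
proof (rule ccontr)
  assume "\<not> ?thesis"
  then have nz: "F x \<noteq> 0" if "x \<in> cball 0 1" for x using that by blast
  define H where "H x = F x /\<^sub>R norm (F x)" for x
  have "continuous_on (cball 0 1) H"
    unfolding H_def using nz by (intro continuous_intros cont) auto
  moreover have "norm (H x) = 1" if "x \<in> cball 0 1" for x
    using nz[OF that] by (simp add: H_def)
  ultimately obtain a b where ab: "continuous_on (cball 0 1) a" "continuous_on (cball 0 1) b"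
    and sp: "\<And>x. x \<in> cball 0 1 \<Longrightarrow> (a x \<noteq> 0 \<or> b x \<noteq> 0) \<and> spinor (H x) (a x) (b x)"
    using spinor_lift[of H] by metis
  define w where "w x = a x * b (- x) - b x * a (- x)" for x
  have "continuous_on (sphere 0 1) w"
    unfolding w_def
    by (intro continuous_intros continuous_on_subset[OF ab(1)] continuous_on_subset[OF ab(2)]
        continuous_on_compose2[OF ab(1)] continuous_on_compose2[OF ab(2)]) auto
  moreover have "w (- x) = - w x" for x
    by (simp add: w_def)
  ultimately obtain x where x: "x \<in> sphere 0 1" "w x = 0"
    using odd_complex_map_on_sphere_has_zero by metis
  have "H (- x) = - H x"
    using odd[OF x(1)] by (simp add: H_def)
  then have "w x \<noteq> 0"
    unfolding w_def using sp[of x] sp[of "- x"] x(1)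
    by (intro spinors_antipodal_independent[of "H x"]) auto
  with x show False by simp
qed

definition extend :: "real ^ 3 \<Rightarrow> real \<Rightarrow> real ^ 4" where
  "extend v s = vector [v $ 1, v $ 2, v $ 3, s]"

lemma extend_nth [simp]:
  "extend v s $ 1 = v $ 1" "extend v s $ 2 = v $ 2" "extend v s $ 3 = v $ 3" "extend v s $ 4 = s"
  by (simp_all add: extend_def vector_def)

lemma inner_extend [simp]: "extend v s \<bullet> extend w t = v \<bullet> w + s * t"
  by (simp add: inner_vec_def sum_4 sum_3)

lemma uminus_extend: "- extend v s = extend (- v) (- s)"
  by (simp add: vec_eq_iff forall_4)

lemma extend_cases: obtains v s where "y = extend v s"
proof
  show "y = extend (vector [y $ 1, y $ 2, y $ 3]) (y $ 4)"
    by (simp add: vec_eq_iff forall_4)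
qed

lemma norm_extend_eq_1_iff: "norm (extend v s) = 1 \<longleftrightarrow> (norm v)\<^sup>2 + s\<^sup>2 = 1"
  by (simp add: norm_eq_1 power2_norm_eq_inner power2_eq_square[of s])

lemma continuous_on_extend:
  assumes "continuous_on A f" "continuous_on A g"
  shows "continuous_on A (\<lambda>x. extend (f x) (g x))"
proof -
  have "continuous_on A (\<lambda>x. extend (f x) (g x) $ i)" for i
    using exhaust_4[of i] assms by (elim disjE) (simp_all add: continuous_on_component)
  then show ?thesis
    by (simp add: continuous_on_vec_lambda[of A "\<lambda>i x. extend (f x) (g x) $ i", simplified])
qed

text \<open>
  The upper hemisphere is a ball whose boundary is the equator, on which the two notions of
  antipode agree.
\<close>

theorem borsuk_ulam_4_3:
  fixes F :: "real ^ 4 \<Rightarrow> real ^ 3"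
  assumes cont: "continuous_on (sphere 0 1) F"
    and odd: "\<And>y. y \<in> sphere 0 1 \<Longrightarrow> F (- y) = - F y"
  shows "\<exists>y\<in>sphere 0 1. F y = 0"
proof -
  define hem where "hem x = extend x (sqrt (1 - (norm x)\<^sup>2))" for x
  have hem: "hem x \<in> sphere 0 1" if "x \<in> cball 0 1" for x
  proof -
    have "(norm x)\<^sup>2 \<le> 1" using that by (simp add: power_le_one)
    then show ?thesis by (simp add: hem_def norm_extend_eq_1_iff)
  qed
  have "continuous_on (cball 0 1) (\<lambda>x. F (hem x))"
    by (rule continuous_on_compose2[OF cont])
       (use hem in \<open>auto simp: hem_def intro!: continuous_intros continuous_on_extend\<close>)
  moreover have "F (hem (- x)) = - F (hem x)" if "x \<in> sphere 0 1" for x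
  proof -
    have "hem (- x) = - hem x"
      using that by (simp add: hem_def uminus_extend)
    then show ?thesis using odd hem[of x] that by simp
  qed
  ultimately obtain x where "x \<in> cball 0 1" "F (hem x) = 0"
    using odd_on_boundary_has_zero[of "\<lambda>x. F (hem x)"] by blast
  then show ?thesis using hem by blast
qed

section \<open>Distortion of maps between spheres, from below\<close>

text \<open>
  By Caratheodory's theorem it is enough to consider convex combinations \<open>\<Sum> u v *\<^sub>R v\<close> of at
  most \<open>n + 1\<close> vectors, \<open>n\<close> the dimension. The squared norm of such a combination is at least
  \<open>(1 + \<kappa>) \<Sum> (u v)\<^sup>2 - \<kappa> \<ge> (1 + \<kappa>) / (n + 1) - \<kappa> > 0\<close>. The bound \<open>\<kappa> = 1 / n\<close> is the one
  attained by the regular simplex, which is where \<open>zeta2\<close> comes from.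
\<close>

lemma zero_notin_convex_hull_unit_vectors:
  fixes W :: "'a::euclidean_space set"
  assumes unit: "\<And>w. w \<in> W \<Longrightarrow> norm w = 1"
    and inner: "\<And>v w. v \<in> W \<Longrightarrow> w \<in> W \<Longrightarrow> - \<kappa> \<le> v \<bullet> w"
    and \<kappa>: "0 \<le> \<kappa>" "\<kappa> * DIM('a) < 1"
  shows "0 \<notin> convex hull W"
proof
  assume "0 \<in> convex hull W"
  then obtain S where S: "finite S" "S \<subseteq> W" "card S \<le> DIM('a) + 1" "0 \<in> convex hull S"
    unfolding caratheodory[of W] by blast
  then obtain u where u: "\<And>v. v \<in> S \<Longrightarrow> 0 \<le> u v" "sum u S = 1" "(\<Sum>v\<in>S. u v *\<^sub>R v) = 0"
    unfolding convex_hull_finite[OF S(1)] by blast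
  let ?Q = "\<Sum>v\<in>S. (u v)\<^sup>2"
  have "1 = (sum u S)\<^sup>2" using u by simp
  also have "\<dots> \<le> ?Q * card S" by (rule sum_squared_le_sum_of_squares)
  also have "\<dots> \<le> ?Q * (DIM('a) + 1)"
    using S(3) by (intro mult_left_mono) (auto intro: sum_nonneg)
  finally have Q: "1 \<le> ?Q * (DIM('a) + 1)" .
  have "(1 + \<kappa>) * ?Q - \<kappa> = (1 + \<kappa>) * ?Q - \<kappa> * (sum u S * sum u S)"
    using u by simp
  also have "\<dots> = (\<Sum>v\<in>S. \<Sum>w\<in>S. u v * u w * ((if v = w then 1 + \<kappa> else 0) - \<kappa>))"
  proof -
    have "(\<Sum>w\<in>S. u v * u w * ((if v = w then 1 + \<kappa> else 0) - \<kappa>)) =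
        (1 + \<kappa>) * (u v)\<^sup>2 - \<kappa> * (u v * sum u S)" if "v \<in> S" for v
    proof -
      have "(\<Sum>w\<in>S. u v * u w * ((if v = w then 1 + \<kappa> else 0) - \<kappa>)) =
          (\<Sum>w\<in>S. (if v = w then (1 + \<kappa>) * (u v * u w) else 0) - \<kappa> * (u v * u w))"
        by (intro sum.cong refl) (simp add: algebra_simps)
      then show ?thesis
        using S(1) that by (simp add: sum_subtractf sum_distrib_left power2_eq_square)
    qed
    then show ?thesis
      by (simp add: sum_subtractf flip: sum_distrib_left sum_distrib_right)
  qed
  also have "\<dots> \<le> (\<Sum>v\<in>S. \<Sum>w\<in>S. u v * u w * (v \<bullet> w))"
  proof (intro sum_mono mult_left_mono)
    fix v w assume "v \<in> S" "w \<in> S"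
    then have "v \<in> W" "w \<in> W" using S(2) by auto
    then show "(if v = w then 1 + \<kappa> else 0) - \<kappa> \<le> v \<bullet> w"
      using unit[of v] inner[of v w] by (auto simp: dot_square_norm)
    show "0 \<le> u v * u w" using u \<open>v \<in> S\<close> \<open>w \<in> S\<close> by simp
  qed
  also have "\<dots> = (\<Sum>v\<in>S. u v *\<^sub>R v) \<bullet> (\<Sum>v\<in>S. u v *\<^sub>R v)"
    by (simp add: inner_sum_left inner_sum_right sum_distrib_left inner_commute mult_ac)
  finally have "(1 + \<kappa>) * ?Q \<le> \<kappa>" using u by simp
  then have "(1 + \<kappa>) * ?Q * (DIM('a) + 1) \<le> \<kappa> * (DIM('a) + 1)"
    by (rule mult_right_mono) simp
  moreover have "(1 + \<kappa>) * 1 \<le> (1 + \<kappa>) * (?Q * (DIM('a) + 1))"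
    using Q \<kappa> by (intro mult_left_mono) auto
  ultimately show False using \<kappa> by (simp add: algebra_simps)
qed

lemma zeta2_bounds: "pi / 2 \<le> zeta2" "zeta2 < pi" "cos zeta2 = - (1 / 3)"
proof -
  show c: "cos zeta2 = - (1 / 3)" by (simp add: zeta2_def)
  have "arccos 0 \<le> zeta2" unfolding zeta2_def by (rule arccos_le_arccos) auto
  then show "pi / 2 \<le> zeta2" by simp
  have "arccos (- (1 / 3)) < arccos (- 1)" by (rule arccos_less_arccos) auto
  then show "zeta2 < pi" by (simp add: zeta2_def)
qed

lemma arccos_le_iff_cos:
  assumes "-1 \<le> x" "x \<le> 1" "0 \<le> t" "t \<le> pi"
  shows "arccos x \<le> t \<longleftrightarrow> cos t \<le> x"
  using assms cos_mono_le_eq[of t "arccos x"] arccos_lbound arccos_ubound cos_arccos by auto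

text \<open>
  Replacing \<open>(x, y)\<close> by \<open>(- x, - y)\<close> turns both distances into their supplements. Hence the
  distortion of a relation does not change when its antipode is added to it.
\<close>

lemma antipodal_distortion:
  fixes x x' :: "'a::real_inner" and y y' :: "'b::real_inner"
  assumes "norm x = 1" "norm x' = 1" "norm y = 1" "norm y' = 1"
  shows "\<bar>arccos (- (x \<bullet> x')) - arccos (- (y \<bullet> y'))\<bar> = \<bar>arccos (x \<bullet> x') - arccos (y \<bullet> y')\<bar>"
  using inner_sphere_bounds[of x x'] inner_sphere_bounds[of y y'] assms
  by (simp add: arccos_minus)

text \<open>
  Suppose \<open>D < zeta2\<close>. Adding antipodes to the graph of \<open>\<phi>\<close> keeps the distortion, and
  taking at \<open>x\<close> the weighted sum of the values at the close points of a finite antipodally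
  symmetric net gives a continuous odd map \<open>F\<close> into \<open>real ^ 3\<close>. The values in such a sum are pairwise at
  distance less than \<open>zeta2\<close>, so by \<open>zero_notin_convex_hull_unit_vectors\<close> the sum is
  nonzero, against the Borsuk-Ulam theorem.
\<close>

theorem sphere_map_distortion_ge:
  fixes \<phi> :: "real ^ 4 \<Rightarrow> real ^ 3"
  assumes unit: "\<And>y. norm y = 1 \<Longrightarrow> norm (\<phi> y) = 1"
    and dis: "\<And>y y'. norm y = 1 \<Longrightarrow> norm y' = 1 \<Longrightarrow>
                \<bar>arccos (\<phi> y \<bullet> \<phi> y') - arccos (y \<bullet> y')\<bar> \<le> D"
  shows "zeta2 \<le> D"
proof (rule ccontr)
  assume "\<not> zeta2 \<le> D"
  obtain e :: "real ^ 4" where e: "norm e = 1"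
    using vector_choose_size[of 1] by auto
  have "0 \<le> D" using dis[OF e e] by linarith
  define \<epsilon> where "\<epsilon> = (zeta2 - D) / 2"
  \<comment> \<open>Points at Euclidean distance at most \<open>2 * \<delta>\<close> have geodesic distance at most \<open>\<epsilon>\<close>.\<close>
  define \<delta> where "\<delta> = sqrt ((1 - cos \<epsilon>) / 2)"
  have \<epsilon>: "0 < \<epsilon>" "\<epsilon> < pi" "D + \<epsilon> < zeta2"
    using \<open>\<not> zeta2 \<le> D\<close> \<open>0 \<le> D\<close> zeta2_bounds by (simp_all add: \<epsilon>_def field_simps)
  have "cos \<epsilon> < cos 0" using \<epsilon> by (subst cos_mono_less_eq) auto
  then have \<delta>: "0 < \<delta>" "(2 * \<delta>)\<^sup>2 = 2 * (1 - cos \<epsilon>)"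
    by (simp_all add: \<delta>_def power_mult_distrib)
  obtain V :: "(real ^ 4) set" where V: "V \<subseteq> sphere 0 1" "finite V"
    "sphere 0 1 \<subseteq> (\<Union>v\<in>V. ball v \<delta>)"
    by (rule compactE_image[of "sphere (0 :: real ^ 4) 1" "sphere 0 1" "\<lambda>v. ball v \<delta>"])
       (use \<delta>(1) in auto)
  define P where "P = (\<lambda>v. (v, \<phi> v)) ` V \<union> (\<lambda>v. (- v, - \<phi> v)) ` V"
  define k where "k x v = max 0 (\<delta> - norm (x - v))" for x v :: "real ^ 4"
  define F where "F x = (\<Sum>p\<in>P. k x (fst p) *\<^sub>R snd p)" for x
  have finP: "finite P" using V(2) by (simp add: P_def)
  have unitP: "norm (fst p) = 1" "norm (snd p) = 1" if "p \<in> P" for p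
    using that V(1) unit by (auto simp: P_def)
  have disP: "\<bar>arccos (snd p \<bullet> snd q) - arccos (fst p \<bullet> fst q)\<bar> \<le> D" if "p \<in> P" "q \<in> P" for p q
  proof -
    have V1: "norm v = 1" if "v \<in> V" for v using V(1) that by auto
    show ?thesis
      using that by (auto simp: P_def antipodal_distortion V1 unit intro!: dis)
  qed
  have "continuous_on (sphere 0 1) F"
    unfolding F_def k_def by (intro continuous_intros)
  moreover have "F (- x) = - F x" for x
  proof -
    have "k x (- v) = k (- x) v" for v
      unfolding k_def using norm_minus_cancel[of "- x - v"] by (simp add: add.commute)
    then have "F (- x) = (\<Sum>p\<in>P. k x (fst p) *\<^sub>R - snd p)"
      unfolding F_def
      by (intro sum.reindex_bij_witness[of P uminus uminus]) (auto simp: P_def)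
    then show ?thesis by (simp add: F_def sum_negf)
  qed
  ultimately obtain x where x: "x \<in> sphere 0 1" "F x = 0"
    using borsuk_ulam_4_3 by blast
  define P' where "P' = {p \<in> P. norm (x - fst p) < \<delta>}"
  define T where "T = (\<Sum>p\<in>P'. k x (fst p))"
  have finP': "finite P'" using finP by (simp add: P'_def)
  have kpos: "0 < k x (fst p)" if "p \<in> P'" for p
    using that by (simp add: P'_def k_def)
  obtain v where "v \<in> V" "norm (x - v) < \<delta>"
    using V(3) x(1) by (auto simp: dist_norm norm_minus_commute)
  then have "(v, \<phi> v) \<in> P'" by (simp add: P'_def P_def)
  then have T: "T > 0"
    unfolding T_def using finP' kpos by (intro sum_pos) auto
  have "0 = F x /\<^sub>R T" using x by simp
  also have "F x = (\<Sum>p\<in>P'. k x (fst p) *\<^sub>R snd p)"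
    unfolding F_def by (rule sum.mono_neutral_right) (auto simp: finP P'_def k_def)
  also have "\<dots> /\<^sub>R T = (\<Sum>p\<in>P'. (k x (fst p) / T) *\<^sub>R snd p)"
    by (simp add: scaleR_sum_right field_simps)
  also have "\<dots> \<in> convex hull (snd ` P')"
  proof (rule convex_sum)
    show "(\<Sum>p\<in>P'. k x (fst p) / T) = 1"
      using T by (simp add: T_def flip: sum_divide_distrib)
    show "0 \<le> k x (fst p) / T" if "p \<in> P'" for p
      using kpos[OF that] T by simp
    show "snd p \<in> convex hull (snd ` P')" if "p \<in> P'" for p
      using that by (intro hull_inc) simp
  qed (use finP' in auto)
  finally have "0 \<in> convex hull (snd ` P')" .
  moreover have "0 \<notin> convex hull (snd ` P')"
  proof (rule zero_notin_convex_hull_unit_vectors)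
    show "norm w = 1" if "w \<in> snd ` P'" for w
      using that unitP by (auto simp: P'_def)
    show "- max 0 (- cos (D + \<epsilon>)) \<le> v \<bullet> w" if vw: "v \<in> snd ` P'" "w \<in> snd ` P'" for v w
    proof -
      obtain p q where pq: "p \<in> P" "q \<in> P" "v = snd p" "w = snd q"
        "norm (x - fst p) < \<delta>" "norm (x - fst q) < \<delta>"
        using vw unfolding P'_def by blast
      have "norm (fst p - fst q) = norm ((x - fst q) - (x - fst p))" by simp
      also have "\<dots> \<le> norm (x - fst q) + norm (x - fst p)" by (rule norm_triangle_ineq4)
      also have "\<dots> \<le> 2 * \<delta>" using pq by simp
      finally have "(norm (fst p - fst q))\<^sup>2 \<le> 2 * (1 - cos \<epsilon>)"
        using power_mono[of "norm (fst p - fst q)" "2 * \<delta>" 2] \<delta> by simp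
      moreover have "(norm (fst p - fst q))\<^sup>2 = 2 - 2 * (fst p \<bullet> fst q)"
        using unitP[OF pq(1)] unitP[OF pq(2)]
        by (simp add: power2_norm_eq_inner inner_diff inner_commute norm_eq_1)
      ultimately have "cos \<epsilon> \<le> fst p \<bullet> fst q" by simp
      then have "arccos (fst p \<bullet> fst q) \<le> \<epsilon>"
        using unitP[OF pq(1)] unitP[OF pq(2)] \<epsilon> inner_sphere_bounds[of "fst p" "fst q"]
        by (subst arccos_le_iff_cos) auto
      then have "arccos (v \<bullet> w) \<le> D + \<epsilon>"
        using disP[OF pq(1,2)] pq by simp
      then have "cos (D + \<epsilon>) \<le> v \<bullet> w"
        using unitP[OF pq(1)] unitP[OF pq(2)] \<epsilon> \<open>0 \<le> D\<close> inner_sphere_bounds[of v w] zeta2_bounds pq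
        by (subst (asm) arccos_le_iff_cos) auto
      then show ?thesis by linarith
    qed
    have "cos zeta2 < cos (D + \<epsilon>)"
      using \<epsilon> \<open>0 \<le> D\<close> zeta2_bounds by (subst cos_mono_less_eq) auto
    then show "max 0 (- cos (D + \<epsilon>)) * DIM(real ^ 3) < 1"
      using zeta2_bounds(3) by (simp add: max_def)
  qed simp
  ultimately show False by contradiction
qed

text \<open>
  A Hausdorff distance below \<open>r\<close> allows one to choose for every point of \<open>Y\<close> a point of \<open>X\<close>
  at distance less than \<open>r\<close> in \<open>Z\<close>. Boundedness of \<open>Y\<close> guarantees that the supremum in the
  Hausdorff distance is a true supremum.
\<close>

lemma isometric_embedding_selection:
  assumes f: "isometric_embedding X Z f" and g: "isometric_embedding Y Z g"
    and ne: "mspace X \<noteq> {}"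
    and bdd: "\<And>y y'. y \<in> mspace Y \<Longrightarrow> y' \<in> mspace Y \<Longrightarrow> mdist Y y y' \<le> B"
    and less: "hausdorff_distance Z (f ` mspace X) (g ` mspace Y) < r"
  obtains \<phi> where "\<And>y. y \<in> mspace Y \<Longrightarrow> \<phi> y \<in> mspace X"
    "\<And>y y'. y \<in> mspace Y \<Longrightarrow> y' \<in> mspace Y \<Longrightarrow> \<bar>mdist X (\<phi> y) (\<phi> y') - mdist Y y y'\<bar> \<le> 2 * r"
proof -
  have fZ: "f x \<in> mspace Z" if "x \<in> mspace X" for x
    using f that by (auto simp: isometric_embedding_def)
  have gZ: "g y \<in> mspace Z" if "y \<in> mspace Y" for y
    using g that by (auto simp: isometric_embedding_def)
  have below: "bdd_below ((\<lambda>x. mdist Z (f x) (g y)) ` mspace X)" for y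
    by (rule bdd_belowI[of _ 0]) auto
  have near: "\<exists>x\<in>mspace X. mdist Z (f x) (g y) < r" if y: "y \<in> mspace Y" for y
  proof -
    obtain x0 where x0: "x0 \<in> mspace X" using ne by blast
    have "bdd_above ((\<lambda>y. INF x\<in>mspace X. mdist Z (f x) (g y)) ` mspace Y)"
    proof (rule bdd_aboveI2)
      fix y' assume y': "y' \<in> mspace Y"
      have "(INF x\<in>mspace X. mdist Z (f x) (g y')) \<le> mdist Z (f x0) (g y')"
        by (rule cINF_lower[OF below x0])
      also have "\<dots> \<le> mdist Z (f x0) (g y) + mdist Z (g y) (g y')"
        by (intro mdist_triangle fZ gZ x0 y y')
      also have "mdist Z (g y) (g y') \<le> B"
        using g bdd[OF y y'] y y' by (simp add: isometric_embedding_def)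
      finally show "(INF x\<in>mspace X. mdist Z (f x) (g y')) \<le> mdist Z (f x0) (g y) + B" by simp
    qed
    then have "(INF x\<in>mspace X. mdist Z (f x) (g y)) \<le>
        (SUP y\<in>mspace Y. INF x\<in>mspace X. mdist Z (f x) (g y))"
      by (rule cSUP_upper[OF y])
    also have "\<dots> < r"
      using less by (simp add: hausdorff_distance_def image_image)
    finally show ?thesis
      by (simp add: cINF_less_iff[OF ne below])
  qed
  then obtain \<phi> where \<phi>: "\<And>y. y \<in> mspace Y \<Longrightarrow> \<phi> y \<in> mspace X"
    "\<And>y. y \<in> mspace Y \<Longrightarrow> mdist Z (f (\<phi> y)) (g y) < r"
    by metis
  have "\<bar>mdist X (\<phi> y) (\<phi> y') - mdist Y y y'\<bar> \<le> 2 * r" if y: "y \<in> mspace Y" "y' \<in> mspace Y" for y y'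
  proof -
    have m: "f (\<phi> y) \<in> mspace Z" "f (\<phi> y') \<in> mspace Z" "g y \<in> mspace Z" "g y' \<in> mspace Z"
      using fZ gZ \<phi>(1) y by auto
    have "mdist X (\<phi> y) (\<phi> y') = mdist Z (f (\<phi> y)) (f (\<phi> y'))" "mdist Y y y' = mdist Z (g y) (g y')"
      using f g \<phi>(1) y by (auto simp: isometric_embedding_def)
    then show ?thesis
      using mdist_triangle[OF m(1,3,2)] mdist_triangle[OF m(3,4,2)]
        mdist_triangle[OF m(3,1,4)] mdist_triangle[OF m(1,2,4)] \<phi>(2)[OF y(1)] \<phi>(2)[OF y(2)]
        mdist_commute[of Z "g y" "f (\<phi> y)"] mdist_commute[of Z "g y'" "f (\<phi> y')"]
      by linarith
  qed
  with \<phi>(1) show ?thesis using that by blast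
qed

theorem hausdorff_distance_spheres_ge:
  assumes f: "isometric_embedding S2 Z f" and g: "isometric_embedding S3 Z g"
  shows "zeta2 / 2 \<le> hausdorff_distance Z (f ` mspace S2) (g ` mspace S3)"
proof (rule dense_ge)
  fix r assume r: "hausdorff_distance Z (f ` mspace S2) (g ` mspace S3) < r"
  have "mdist S3 y y' \<le> pi" if "y \<in> mspace S3" "y' \<in> mspace S3" for y y'
    using that inner_sphere_bounds[of y y'] by (simp add: mdist_geodesic_sphere arccos_ubound)
  moreover have "mspace S2 \<noteq> {}" by simp
  ultimately obtain \<phi> where \<phi>: "\<And>y. y \<in> mspace S3 \<Longrightarrow> \<phi> y \<in> mspace S2"
    "\<And>y y'. y \<in> mspace S3 \<Longrightarrow> y' \<in> mspace S3 \<Longrightarrow> \<bar>mdist S2 (\<phi> y) (\<phi> y') - mdist S3 y y'\<bar> \<le> 2 * r"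
    using isometric_embedding_selection[OF f g _ _ r] by blast
  have "zeta2 \<le> 2 * r"
  proof (rule sphere_map_distortion_ge)
    show "norm (\<phi> y) = 1" if "norm y = 1" for y
      using \<phi>(1)[of y] that by simp
    show "\<bar>arccos (\<phi> y \<bullet> \<phi> y') - arccos (y \<bullet> y')\<bar> \<le> 2 * r" if "norm y = 1" "norm y' = 1" for y y'
      using \<phi>(2)[of y y'] \<phi>(1)[of y] \<phi>(1)[of y'] that by (simp add: mdist_geodesic_sphere)
  qed
  then show "zeta2 / 2 \<le> r" by simp
qed

section \<open>A correspondence built from a regular tetrahedron\<close>

text \<open>
  Four vertices of the cube, scaled to length one: a regular tetrahedron.
\<close>

definition tet :: "nat \<Rightarrow> real ^ 3" where
  "tet k = (1 / sqrt 3) *\<^sub>R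
     (if k = 0 then vector [1, 1, 1] else if k = 1 then vector [1, -1, -1]
      else if k = 2 then vector [-1, 1, -1] else vector [-1, -1, 1])"

lemma sum_less_4: "(\<Sum>k<4. f k) = f 0 + f 1 + f 2 + f (3 :: nat)" for f :: "nat \<Rightarrow> real"
  by (simp add: eval_nat_numeral)

lemma less_4_cases: "k < 4 \<Longrightarrow> k = 0 \<or> k = 1 \<or> k = 2 \<or> k = (3 :: nat)"
  by linarith

lemma inner_tet_tet: "i < 4 \<Longrightarrow> j < 4 \<Longrightarrow> tet i \<bullet> tet j = (if i = j then 1 else - (1 / 3))"
  by (drule less_4_cases, drule less_4_cases, elim disjE)
     (simp_all add: tet_def inner_vec_def sum_3)

lemma norm_tet: "i < 4 \<Longrightarrow> norm (tet i) = 1"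
  by (simp add: norm_eq_1 inner_tet_tet)

lemma sum_inner_tet: "(\<Sum>k<4. x \<bullet> tet k) = 0"
  by (simp add: sum_less_4 tet_def inner_vec_def sum_3 field_simps)

text \<open>
  The vertices form a tight frame. This and \<open>sum_inner_tet\<close> replace all coordinates in the
  estimates on the cells below.
\<close>

lemma tet_frame: "(\<Sum>k<4. (x \<bullet> tet k) * (y \<bullet> tet k)) = 4 / 3 * (x \<bullet> y)"
  by (simp add: sum_less_4 tet_def inner_vec_def sum_3 field_simps)

text \<open>
  The Voronoi cell of the \<open>i\<close>-th vertex.
\<close>

definition in_cell :: "nat \<Rightarrow> real ^ 3 \<Rightarrow> bool" where
  "in_cell i x \<longleftrightarrow> i < 4 \<and> (\<forall>k<4. x \<bullet> tet k \<le> x \<bullet> tet i)"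

lemma in_cell_exists: "\<exists>i. in_cell i x"
proof -
  have "Max ((\<lambda>k. x \<bullet> tet k) ` {..<4}) \<in> (\<lambda>k. x \<bullet> tet k) ` {..<4}"
    by (rule Max_in) (auto simp: lessThan_empty_iff)
  then obtain i where i: "i < 4" "Max ((\<lambda>k. x \<bullet> tet k) ` {..<4}) = x \<bullet> tet i"
    by auto
  have "x \<bullet> tet k \<le> x \<bullet> tet i" if "k < 4" for k
    unfolding i(2)[symmetric] using that by (intro Max_ge) auto
  then show ?thesis using i by (auto simp: in_cell_def)
qed

text \<open>
  All factors of the products \<open>(x \<bullet> tet i - x \<bullet> tet k) * (x' \<bullet> tet i - x' \<bullet> tet k)\<close> are
  nonnegative on the cell, and by the frame identity the products add up to
  \<open>4 * ((x \<bullet> tet i) * (x' \<bullet> tet i)) + 4 / 3 * (x \<bullet> x')\<close>.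
\<close>

lemma cell_inner_ge:
  assumes "in_cell i x" "in_cell i x'"
  shows "- 3 * ((x \<bullet> tet i) * (x' \<bullet> tet i)) \<le> x \<bullet> x'"
proof -
  let ?u = "x \<bullet> tet i" and ?u' = "x' \<bullet> tet i"
  have "0 \<le> (\<Sum>k<4. (?u - x \<bullet> tet k) * (?u' - x' \<bullet> tet k))"
    using assms by (intro sum_nonneg mult_nonneg_nonneg) (auto simp: in_cell_def)
  also have "\<dots> = 4 * (?u * ?u') - ?u * (\<Sum>k<4. x' \<bullet> tet k) - ?u' * (\<Sum>k<4. x \<bullet> tet k)
      + (\<Sum>k<4. (x \<bullet> tet k) * (x' \<bullet> tet k))"
    by (simp add: algebra_simps sum.distrib sum_subtractf sum_distrib_left)
  finally show ?thesis by (simp add: sum_inner_tet tet_frame)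
qed

text \<open>
  With \<open>u = x \<bullet> tet i\<close>, each \<open>x \<bullet> tet k\<close> lies in \<open>[- 3 * u, u]\<close>, since it is at most \<open>u\<close> and the four
  numbers add up to zero. Summing \<open>(u - x \<bullet> tet k) * (3 * u + x \<bullet> tet k) \<ge> 0\<close> yields
  \<open>12 * u\<^sup>2 \<ge> 4 / 3\<close>. Equality holds at the corners of the cell, the antipodes of the other vertices.
\<close>

lemma cell_centre_ge:
  assumes "in_cell i x" "norm x = 1"
  shows "1 / 3 \<le> x \<bullet> tet i"
proof -
  let ?u = "x \<bullet> tet i"
  have le: "x \<bullet> tet k \<le> ?u" if "k < 4" for k using assms that by (auto simp: in_cell_def)
  have "0 \<le> (\<Sum>k<4. ?u - x \<bullet> tet k)" using le by (intro sum_nonneg) auto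
  then have u: "0 \<le> ?u" by (simp add: sum_subtractf sum_inner_tet)
  have "0 \<le> (?u - x \<bullet> tet k) * (3 * ?u + x \<bullet> tet k)" if k: "k < 4" for k
  proof (rule mult_nonneg_nonneg)
    have "0 \<le> (\<Sum>l\<in>{..<4} - {k}. ?u - x \<bullet> tet l)" using le by (intro sum_nonneg) auto
    also have "\<dots> = (\<Sum>l<4. ?u - x \<bullet> tet l) - (?u - x \<bullet> tet k)"
      using k by (subst sum_diff1) auto
    finally show "0 \<le> 3 * ?u + x \<bullet> tet k" by (simp add: sum_subtractf sum_inner_tet)
  qed (use le k in auto)
  then have "0 \<le> (\<Sum>k<4. (?u - x \<bullet> tet k) * (3 * ?u + x \<bullet> tet k))"
    by (intro sum_nonneg) auto
  also have "\<dots> = 12 * ?u\<^sup>2 - 2 * ?u * (\<Sum>k<4. x \<bullet> tet k) - (\<Sum>k<4. (x \<bullet> tet k) * (x \<bullet> tet k))"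
    by (simp add: algebra_simps sum.distrib sum_subtractf sum_distrib_left power2_eq_square)
  also have "\<dots> = 12 * ?u\<^sup>2 - 4 / 3"
    using assms(2) by (simp add: sum_inner_tet tet_frame norm_eq_1)
  finally have "(1 / 3)\<^sup>2 \<le> ?u\<^sup>2" by (simp add: power2_eq_square)
  then show ?thesis using u by (rule power2_le_imp_le)
qed

text \<open>
  Cauchy-Schwarz for the components of \<open>x\<close> and \<open>y\<close> orthogonal to \<open>p\<close>; these are the two triangle
  inequalities for the spherical triangle \<open>x, p, y\<close>, written with inner products.
\<close>

lemma inner_via_third_unit_vector:
  fixes x y p :: "'a::real_inner"
  assumes "norm x = 1" "norm y = 1" "norm p = 1"
  shows "\<bar>x \<bullet> y - (x \<bullet> p) * (y \<bullet> p)\<bar> \<le> sqrt (1 - (x \<bullet> p)\<^sup>2) * sqrt (1 - (y \<bullet> p)\<^sup>2)"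
proof -
  let ?x = "x - (x \<bullet> p) *\<^sub>R p" and ?y = "y - (y \<bullet> p) *\<^sub>R p"
  have sq: "x \<bullet> x = 1" "y \<bullet> y = 1" "p \<bullet> p = 1"
    using assms by (simp_all add: norm_eq_1)
  have "norm ?x = sqrt (1 - (x \<bullet> p)\<^sup>2)" "norm ?y = sqrt (1 - (y \<bullet> p)\<^sup>2)"
    by (simp_all add: norm_eq_sqrt_inner inner_diff_left inner_diff_right sq inner_commute[of p x] inner_commute[of p y]
        power2_eq_square)
  moreover have "?x \<bullet> ?y = x \<bullet> y - (x \<bullet> p) * (y \<bullet> p)"
    by (simp add: inner_diff_left inner_diff_right sq inner_commute[of p x] inner_commute[of p y])
  ultimately show ?thesis
    using Cauchy_Schwarz_ineq2[of ?x ?y] by simp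
qed

text \<open>
  The height at which the band over a point \<open>x\<close> of the cell of \<open>p\<close> ends and the cap begins, as
  a function of \<open>u = x \<bullet> p\<close>. Three requirements compete. A point of the band and a point of
  another cap must not be closer than their partners by more than \<open>zeta2\<close>, which is the reason for
  the bound \<open>u\<close>. Two points of the same cap have the same partner, so their distance must be at most
  \<open>zeta2\<close>, and for this the height must not be too small. Two points of the bands must not be closer than
  their partners by more than \<open>zeta2\<close>, which a uniform bound ensures; \<open>1 / sqrt 3\<close> is the value of \<open>u\<close> at
  which the estimate of \<open>cap_inner_ge\<close> for the height \<open>u\<close> becomes an equality.
\<close>

definition cut_height :: "real \<Rightarrow> real" where
  "cut_height u = min u (1 / sqrt 3)"

lemma cut_height_ge: "1 / 3 \<le> u \<Longrightarrow> 1 / 3 \<le> cut_height u"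
proof -
  have "sqrt 3 \<le> sqrt (3\<^sup>2)" by (intro real_sqrt_le_mono) simp
  then show "1 / 3 \<le> u \<Longrightarrow> 1 / 3 \<le> cut_height u"
    by (simp add: cut_height_def divide_simps)
qed

text \<open>
  If \<open>x\<close> is within \<open>arccos (1 / sqrt 3)\<close> of the centre of its cell, then the triangle inequality through
  the centre already bounds \<open>x \<bullet> x'\<close> from below by \<open>- 1 / sqrt 3\<close>, and heights of at least
  \<open>1 / sqrt 3\<close> and \<open>1 / 3\<close> suffice.
\<close>

lemma cap_inner_ge_wide:
  assumes unit: "norm x = 1" "norm x' = 1" and i: "in_cell i x" "in_cell i x'"
    and c: "0 \<le> c" "0 \<le> c'" "c\<^sup>2 + s\<^sup>2 = 1" "c'\<^sup>2 + s'\<^sup>2 = 1"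
    and s: "cut_height (x \<bullet> tet i) \<le> s" "cut_height (x' \<bullet> tet i) \<le> s'"
    and wide: "1 / sqrt 3 \<le> x \<bullet> tet i"
  shows "- (1 / 3) \<le> c * c' * (x \<bullet> x') + s * s'"
proof -
  define a where "a = 1 / sqrt 3"
  have a: "0 < a" "a * a = 1 / 3" by (simp_all add: a_def)
  let ?u = "x \<bullet> tet i" and ?u' = "x' \<bullet> tet i"
  have i4: "norm (tet i) = 1" using i by (simp add: in_cell_def norm_tet)
  have u': "1 / 3 \<le> ?u'" using i(2) unit(2) by (rule cell_centre_ge)
  have s1: "a \<le> s" using s(1) wide by (simp add: cut_height_def a_def)
  have s': "1 / 3 \<le> s'" using cut_height_ge[OF u'] s(2) by simp
  have s3: "1 / 3 \<le> s" using cut_height_ge[OF cell_centre_ge[OF i(1) unit(1)]] s(1) by simp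
  have wide': "a \<le> ?u" using wide by (simp add: a_def)
  have sq: "1 / 3 \<le> ?u\<^sup>2" "1 / 9 \<le> ?u'\<^sup>2" "1 / 3 \<le> s\<^sup>2" "1 / 9 \<le> s'\<^sup>2"
    using power_mono[OF wide', of 2] power_mono[OF u', of 2] power_mono[OF s1, of 2] power_mono[OF s', of 2] a
    by (simp_all add: power_divide power2_eq_square[of a])
  have k: "sqrt (2 / 3) * sqrt (8 / 9) = 4 / 3 * a"
    by (simp add: real_sqrt_divide real_sqrt_mult[symmetric] a_def)
  have "c * c' \<le> sqrt (2 / 3) * sqrt (8 / 9)"
    using c sq by (intro mult_mono real_le_rsqrt) auto
  then have cc: "c * c' \<le> 4 / 3 * a" unfolding k .
  have "sqrt (1 - ?u\<^sup>2) * sqrt (1 - ?u'\<^sup>2) \<le> sqrt (2 / 3) * sqrt (8 / 9)"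
    using sq inner_sphere_bounds[OF unit(2) i4]
    by (intro mult_mono real_sqrt_le_mono) (auto simp: abs_square_le_1)
  moreover have "a * (1 / 3) \<le> ?u * ?u'"
    using wide' u' a by (intro mult_mono) auto
  ultimately have X: "- a \<le> x \<bullet> x'"
    using inner_via_third_unit_vector[OF unit i4] unfolding k by linarith
  have "c * c' * (- a) \<le> c * c' * (x \<bullet> x')"
    using X c by (intro mult_left_mono) auto
  moreover have "c * c' * a \<le> 4 / 3 * a * a"
    using cc a by (intro mult_right_mono) auto
  moreover have "1 / 3 * (1 / 3) \<le> s * s'"
    using s3 s' by (intro mult_mono) auto
  moreover have "4 / 3 * a * a = 4 / 9" using a(2) by (simp add: mult.assoc)
  ultimately show ?thesis by simp
qed

text \<open>
  Two points over the same cell, both above the cut, have distance at most \<open>zeta2\<close>. When neither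
  base point is close to the centre, put \<open>w = (x \<bullet> tet i) * (x' \<bullet> tet i)\<close>: then \<open>x \<bullet> x' \<ge> - 3 * w\<close>,
  \<open>s * s' \<ge> w\<close> and, by the inequality of the means, \<open>c * c' \<le> 1 - w\<close>, which leaves
  \<open>3 * w\<^sup>2 - 2 * w + 1 / 3 = 3 * (w - 1 / 3)\<^sup>2 \<ge> 0\<close>.
\<close>

lemma cap_inner_ge:
  assumes unit: "norm x = 1" "norm x' = 1" and i: "in_cell i x" "in_cell i x'"
    and c: "0 \<le> c" "0 \<le> c'" "c\<^sup>2 + s\<^sup>2 = 1" "c'\<^sup>2 + s'\<^sup>2 = 1"
    and s: "cut_height (x \<bullet> tet i) \<le> s" "cut_height (x' \<bullet> tet i) \<le> s'"
  shows "- (1 / 3) \<le> c * c' * (x \<bullet> x') + s * s'"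
proof -
  let ?u = "x \<bullet> tet i" and ?u' = "x' \<bullet> tet i"
  consider "1 / sqrt 3 \<le> ?u" | "1 / sqrt 3 \<le> ?u'" | "?u \<le> 1 / sqrt 3" "?u' \<le> 1 / sqrt 3" by linarith
  then show ?thesis
  proof cases
    case 1
    then show ?thesis using cap_inner_ge_wide assms by blast
  next
    case 2
    then show ?thesis
      using cap_inner_ge_wide[of x' x i c' c s' s] assms by (simp add: inner_commute mult.commute)
  next
    case 3
    have u: "0 \<le> ?u" "0 \<le> ?u'"
      using cell_centre_ge[OF i(1) unit(1)] cell_centre_ge[OF i(2) unit(2)] by auto
    have su: "?u \<le> s" "?u' \<le> s'" using s 3 by (simp_all add: cut_height_def)
    let ?w = "?u * ?u'"
    have "?u\<^sup>2 \<le> s\<^sup>2" "?u'\<^sup>2 \<le> s'\<^sup>2" using u su by (auto intro: power_mono)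
    moreover have "0 \<le> (c - c')\<^sup>2" "0 \<le> (?u - ?u')\<^sup>2" by simp_all
    ultimately have cc: "c * c' \<le> 1 - ?w"
      using c(3,4) by (simp add: power2_diff)
    have "- (1 / 3) \<le> - 3 * ((1 - ?w) * ?w) + ?w"
      using zero_le_power2[of "?w - 1 / 3"] by (simp add: power2_eq_square algebra_simps)
    also have "(1 - ?w) * ?w \<ge> c * c' * ?w"
      using cc u by (intro mult_right_mono) auto
    then have "- 3 * ((1 - ?w) * ?w) + ?w \<le> c * c' * (- 3 * ?w) + ?w" by simp
    also have "\<dots> \<le> c * c' * (x \<bullet> x') + s * s'"
      using cell_inner_ge[OF i] c u su by (intro add_mono mult_left_mono mult_mono) auto
    finally show ?thesis .
  qed
qed

text \<open>
  The right-hand side is the cosine of \<open>arccos (x \<bullet> p) - zeta2\<close>. Over the whole vertical half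
  circle above \<open>x'\<close>, the left-hand side is at most \<open>sqrt (c\<^sup>2 * (x \<bullet> x')\<^sup>2 + s\<^sup>2)\<close>, which is bounded
  through \<open>s\<^sup>2 \<le> 1 / 3\<close> and the largest value that \<open>x \<bullet> x'\<close> can take when \<open>x' \<bullet> p \<ge> 1 / 3\<close> and the
  distance of \<open>x\<close> from \<open>p\<close> is given. What remains is a quadratic inequality between \<open>t\<close> and \<open>r = sqrt (1 - t\<^sup>2)\<close>, valid
  where \<open>t \<le> sqrt 8 * r\<close> (from \<open>x \<bullet> x' > 0\<close>) and \<open>r \<le> sqrt 8 * t\<close> (from \<open>t \<ge> 1 / 3\<close>).
\<close>

lemma band_cap_inner_le:
  fixes x x' p :: "'a::real_inner"
  assumes unit: "norm x = 1" "norm x' = 1" "norm p = 1"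
    and c: "c\<^sup>2 + s\<^sup>2 = 1" "c'\<^sup>2 + s'\<^sup>2 = 1" and s: "0 \<le> s" "s \<le> 1 / sqrt 3"
    and p: "1 / 3 \<le> x' \<bullet> p" and t: "t = - (x \<bullet> p)" "1 / 3 \<le> t" and X: "0 < x \<bullet> x'"
  shows "c * c' * (x \<bullet> x') + s * s' \<le> (t + sqrt 8 * sqrt (1 - t\<^sup>2)) / 3"
proof -
  let ?X = "x \<bullet> x'"
  define r where "r = sqrt (1 - t\<^sup>2)"
  have t1: "t\<^sup>2 \<le> 1"
    using inner_sphere_bounds[OF unit(1,3)] by (simp add: t abs_square_le_1 abs_le_iff)
  then have r: "0 \<le> r" "r\<^sup>2 = 1 - t\<^sup>2" by (simp_all add: r_def)
  have "1 / 9 \<le> (x' \<bullet> p)\<^sup>2" using power_mono[OF p, of 2] by (simp add: power_divide)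
  then have "sqrt (1 - (x' \<bullet> p)\<^sup>2) \<le> sqrt (8 / 9)" by (intro real_sqrt_le_mono) simp
  then have "r * sqrt (1 - (x' \<bullet> p)\<^sup>2) \<le> r * (sqrt 8 / 3)"
    using r by (intro mult_left_mono) (auto simp: real_sqrt_divide)
  moreover have "t * (1 / 3) \<le> t * (x' \<bullet> p)"
    using p t(2) by (intro mult_left_mono) auto
  ultimately have X0: "?X \<le> (sqrt 8 * r - t) / 3"
    using inner_via_third_unit_vector[OF unit] t(1) by (simp add: abs_le_iff field_simps r_def)
  have rt: "t \<le> sqrt 8 * r" using X X0 by simp
  have "1 / 9 \<le> t\<^sup>2" using power_mono[OF t(2), of 2] by (simp add: power_divide)
  then have "r\<^sup>2 \<le> (sqrt 8 * t)\<^sup>2" unfolding r(2) by (simp add: power_mult_distrib)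
  then have rt': "r \<le> sqrt 8 * t" by (rule power2_le_imp_le) (use t(2) in simp)
  define m where "m = sqrt 8 * r * t"
  \<comment> \<open>The two constraints on the ratio of \<open>t\<close> and \<open>r\<close>, multiplied by \<open>r\<close> and by \<open>t\<close>.\<close>
  have "r * r \<le> m"
    unfolding m_def using mult_left_mono[OF rt' r(1)] by (simp only: mult_ac)
  moreover have "t * t \<le> m"
    unfolding m_def using mult_left_mono[OF rt, of t] t(2) by (simp only: mult_ac)
  ultimately have poly: "r\<^sup>2 + 8 * t\<^sup>2 \<le> 10 * m"
    using zero_le_square[of r] unfolding power2_eq_square by linarith
  have s2: "s\<^sup>2 \<le> 1 / 3" using power_mono[OF s(2) s(1), of 2] by (simp add: power_divide)
  have X1: "?X\<^sup>2 \<le> 1"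
    using inner_sphere_bounds[OF unit(1,2)] by (simp add: abs_square_le_1 abs_le_iff)
  have "(c * c' * ?X + s * s')\<^sup>2 \<le> (c'\<^sup>2 + s'\<^sup>2) * ((c * ?X)\<^sup>2 + s\<^sup>2)"
    using zero_le_power2[of "c' * s - s' * (c * ?X)"] by (simp add: power2_eq_square algebra_simps)
  also have "\<dots> = ?X\<^sup>2 + s\<^sup>2 * (1 - ?X\<^sup>2)"
  proof -
    have cs: "c\<^sup>2 = 1 - s\<^sup>2" using c by simp
    show ?thesis unfolding c(2) power_mult_distrib cs by (simp add: algebra_simps)
  qed
  also have "\<dots> \<le> ?X\<^sup>2 + 1 / 3 * (1 - ?X\<^sup>2)"
    using s2 X1 by (intro add_left_mono mult_right_mono) auto
  also have "\<dots> \<le> 1 / 3 + 2 / 3 * ((sqrt 8 * r - t) / 3)\<^sup>2"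
  proof -
    have "?X\<^sup>2 \<le> ((sqrt 8 * r - t) / 3)\<^sup>2"
      using X by (intro power_mono X0) simp
    moreover have "A + 1 / 3 * (1 - A) \<le> 1 / 3 + 2 / 3 * B" if "A \<le> B" for A B :: real
      using that by (simp add: field_simps)
    ultimately show ?thesis by blast
  qed
  also have "\<dots> \<le> ((t + sqrt 8 * r) / 3)\<^sup>2"
  proof -
    have "(sqrt 8 * r - t)\<^sup>2 = 8 * r\<^sup>2 - 2 * m + t\<^sup>2"
      "(t + sqrt 8 * r)\<^sup>2 = 8 * r\<^sup>2 + 2 * m + t\<^sup>2"
      by (simp_all add: m_def power2_diff power2_sum power_mult_distrib)
    then show ?thesis using poly r(2) by (simp add: power_divide)
  qed
  finally show ?thesis
    unfolding r_def[symmetric] by (rule power2_le_imp_le) (use r t(2) in simp)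
qed

text \<open>
  The correspondence over the closed upper hemisphere. A point at height \<open>s\<close> above the point \<open>x\<close>
  of the equator is paired with \<open>x\<close> while it is low (\<open>band\<close>), and with the vertex whose
  cell contains \<open>x\<close> when it is high (\<open>cap\<close>). At the cut, on cell boundaries and at the pole several
  partners are allowed.
\<close>

definition band :: "((real ^ 3) \<times> (real ^ 4)) set" where
  "band = {(x, extend (c *\<^sub>R x) s) | x c s i.
     norm x = 1 \<and> in_cell i x \<and> 0 \<le> c \<and> 0 \<le> s \<and> c\<^sup>2 + s\<^sup>2 = 1 \<and> s \<le> cut_height (x \<bullet> tet i)}"

definition cap :: "((real ^ 3) \<times> (real ^ 4)) set" where
  "cap = {(tet i, extend (c *\<^sub>R x) s) | x c s i.
     norm x = 1 \<and> in_cell i x \<and> 0 \<le> c \<and> c\<^sup>2 + s\<^sup>2 = 1 \<and> cut_height (x \<bullet> tet i) \<le> s}"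

lemma band_cases:
  assumes "(p, y) \<in> band"
  obtains c s i where "y = extend (c *\<^sub>R p) s" "norm p = 1" "in_cell i p" "0 \<le> c" "0 \<le> s"
    "c\<^sup>2 + s\<^sup>2 = 1" "s \<le> p \<bullet> tet i" "s \<le> 1 / sqrt 3"
  using assms unfolding band_def cut_height_def by auto

lemma cap_cases:
  assumes "(p, y) \<in> cap"
  obtains x c s i where "p = tet i" "y = extend (c *\<^sub>R x) s" "norm x = 1" "in_cell i x" "i < 4" "0 \<le> c"
    "0 \<le> s" "c\<^sup>2 + s\<^sup>2 = 1" "cut_height (x \<bullet> tet i) \<le> s"
proof -
  obtain x c s i where *: "p = tet i" "y = extend (c *\<^sub>R x) s" "norm x = 1" "in_cell i x" "0 \<le> c"
    "c\<^sup>2 + s\<^sup>2 = 1" "cut_height (x \<bullet> tet i) \<le> s"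
    using assms unfolding cap_def by blast
  moreover have "0 \<le> s" using cut_height_ge[OF cell_centre_ge[OF *(4,3)]] *(7) by simp
  moreover have "i < 4" using *(4) by (simp add: in_cell_def)
  ultimately show ?thesis using that by blast
qed

lemma norm_extend_scaleR: "norm x = 1 \<Longrightarrow> c\<^sup>2 + s\<^sup>2 = 1 \<Longrightarrow> norm (extend (c *\<^sub>R x) s) = 1"
  by (simp add: norm_extend_eq_1_iff power_mult_distrib)

lemma band_cap_unit: "(p, y) \<in> band \<union> cap \<Longrightarrow> norm p = 1 \<and> norm y = 1"
  by (auto elim!: band_cases cap_cases simp: norm_extend_scaleR norm_tet)

lemma le_1_of_sum_squares: "c \<le> 1" if "c\<^sup>2 + s\<^sup>2 = 1" for c s :: real
proof (rule power2_le_imp_le)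
  show "c\<^sup>2 \<le> 1\<^sup>2" using that zero_le_power2[of s] unfolding one_power2 by linarith
qed simp

text \<open>
  Points of the band are within \<open>pi / 4\<close> of their partners on the equator, so two such moves cost at
  most \<open>pi / 2 \<le> zeta2\<close>.
\<close>

lemma band_band_distortion:
  assumes "(p, y) \<in> band" "(p', y') \<in> band"
  shows "\<bar>arccos (p \<bullet> p') - arccos (y \<bullet> y')\<bar> \<le> zeta2"
proof -
  have near: "arccos (extend p 0 \<bullet> y) \<le> pi / 4" if py: "(p, y) \<in> band" for p y
    using py
  proof (rule band_cases)
    fix c s i assume *: "y = extend (c *\<^sub>R p) s" "norm p = 1" "0 \<le> c" "0 \<le> s" "c\<^sup>2 + s\<^sup>2 = 1"
      "s \<le> 1 / sqrt 3"
    have "s\<^sup>2 \<le> 1 / 3" using power_mono[OF *(6) *(4), of 2] by (simp add: power_divide)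
    then have "sqrt (1 / 2) \<le> c" using * by (intro real_le_lsqrt) auto
    moreover have "sqrt (1 / 2) = cos (pi / 4)"
      by (simp add: cos_45 real_sqrt_divide real_div_sqrt field_simps)
    moreover have "c \<le> 1" using *(5) by (rule le_1_of_sum_squares)
    moreover have "extend p 0 \<bullet> y = c" using * by (simp add: norm_eq_1)
    ultimately show ?thesis using arccos_le_iff_cos[of c "pi / 4"] \<open>0 \<le> c\<close> by simp
  qed
  have n: "norm (extend p 0) = 1" "norm (extend p' 0) = 1" "norm y = 1" "norm y' = 1"
    using band_cap_unit[of p y] band_cap_unit[of p' y'] assms by (simp_all add: norm_extend_eq_1_iff)
  have pp': "p \<bullet> p' = extend p 0 \<bullet> extend p' 0" by simp
  show ?thesis
    using near[OF assms(1)] near[OF assms(2)] zeta2_bounds(1)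
      arccos_inner_triangle[OF n(1,3,2)] arccos_inner_triangle[OF n(3,4,2)]
      arccos_inner_triangle[OF n(3,1,4)] arccos_inner_triangle[OF n(1,2,4)]
    unfolding pp' inner_commute[of y' "extend p' 0"] inner_commute[of y "extend p 0"]
    by linarith
qed

text \<open>
  Points over different cells have partners at distance exactly \<open>zeta2\<close>, and no distance differs from
  \<open>zeta2\<close> by more than \<open>zeta2\<close> because \<open>pi \<le> 2 * zeta2\<close>. Points over the same cell are the subject of
  \<open>cap_inner_ge\<close>.
\<close>

lemma cap_cap_distortion:
  assumes "(p, y) \<in> cap" "(p', y') \<in> cap"
  shows "\<bar>arccos (p \<bullet> p') - arccos (y \<bullet> y')\<bar> \<le> zeta2"
proof -
  have b: "-1 \<le> y \<bullet> y'" "y \<bullet> y' \<le> 1"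
    using band_cap_unit[of p y] band_cap_unit[of p' y'] assms inner_sphere_bounds[of y y'] by auto
  have a: "0 \<le> arccos (y \<bullet> y')" "arccos (y \<bullet> y') \<le> pi"
    using b by (simp_all add: arccos_lbound arccos_ubound)
  from assms(1) obtain x c s i where 1: "p = tet i" "y = extend (c *\<^sub>R x) s" "norm x = 1" "in_cell i x"
    "i < 4" "0 \<le> c" "0 \<le> s" "c\<^sup>2 + s\<^sup>2 = 1" "cut_height (x \<bullet> tet i) \<le> s" by (rule cap_cases)
  from assms(2) obtain x' c' s' j where 2: "p' = tet j" "y' = extend (c' *\<^sub>R x') s'" "norm x' = 1"
    "in_cell j x'" "j < 4" "0 \<le> c'" "0 \<le> s'" "c'\<^sup>2 + s'\<^sup>2 = 1" "cut_height (x' \<bullet> tet j) \<le> s'" by (rule cap_cases)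
  show ?thesis
  proof (cases "i = j")
    case True
    have "- (1 / 3) \<le> c * c' * (x \<bullet> x') + s * s'"
      using 1 2 True by (intro cap_inner_ge[of x x' i]) auto
    then have "- (1 / 3) \<le> y \<bullet> y'" by (simp add: 1 2 mult_ac)
    then have "arccos (y \<bullet> y') \<le> zeta2"
      unfolding zeta2_def using b by (intro arccos_le_arccos) auto
    then show ?thesis using a 1 2 True by (simp add: inner_tet_tet)
  next
    case False
    then have "arccos (p \<bullet> p') = zeta2" using 1 2 by (simp add: inner_tet_tet zeta2_def)
    then show ?thesis using a zeta2_bounds by linarith
  qed
qed

text \<open>
  The point \<open>y\<close> sits above \<open>p\<close>, the point \<open>y'\<close> above \<open>x'\<close>, which is in the cell of \<open>p'\<close>.

  The distance of \<open>y\<close> and \<open>y'\<close> is not too large: it is at most a right angle or at most the distance of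
  \<open>p\<close> and \<open>y'\<close>, and \<open>y'\<close> is within a right angle of \<open>p'\<close>.

  It is not too small either: if \<open>x'\<close> is at least a right angle away from \<open>p\<close>, then \<open>y\<close> and \<open>y'\<close> are
  at least as far apart as \<open>p\<close> and the centre of its own cell, which is at distance at most
  \<open>zeta2\<close> from \<open>p'\<close>; this is why the band ends at height \<open>p \<bullet> tet i\<close>. Otherwise
  \<open>band_cap_inner_le\<close> applies.
\<close>

lemma band_cap_distortion:
  assumes "(p, y) \<in> band" "(p', y') \<in> cap"
  shows "\<bar>arccos (p \<bullet> p') - arccos (y \<bullet> y')\<bar> \<le> zeta2"
proof -
  from assms(1) obtain c s i where 1: "y = extend (c *\<^sub>R p) s" "norm p = 1" "in_cell i p" "0 \<le> c" "0 \<le> s"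
    "c\<^sup>2 + s\<^sup>2 = 1" "s \<le> p \<bullet> tet i" "s \<le> 1 / sqrt 3" by (rule band_cases)
  from assms(2) obtain x' c' s' j where 2: "p' = tet j" "y' = extend (c' *\<^sub>R x') s'" "norm x' = 1"
    "in_cell j x'" "j < 4" "0 \<le> c'" "0 \<le> s'" "c'\<^sup>2 + s'\<^sup>2 = 1" "cut_height (x' \<bullet> tet j) \<le> s'" by (rule cap_cases)
  have n: "norm p = 1" "norm p' = 1" "norm y = 1" "norm y' = 1"
    using band_cap_unit[of p y] band_cap_unit[of p' y'] assms by auto
  have b: "-1 \<le> y \<bullet> y'" "y \<bullet> y' \<le> 1" using inner_sphere_bounds[OF n(3,4)] .
  have bp: "-1 \<le> p \<bullet> p'" "p \<bullet> p' \<le> 1" using inner_sphere_bounds[OF n(1,2)] .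
  let ?X = "p \<bullet> x'"
  have yy': "y \<bullet> y' = c * c' * ?X + s * s'" by (simp add: 1 2 mult_ac)
  have u': "1 / 3 \<le> x' \<bullet> tet j" using 2 by (intro cell_centre_ge)
  have c1: "c \<le> 1" "s' \<le> 1"
    using le_1_of_sum_squares[of c s] le_1_of_sum_squares[of s' c'] 1(6) 2(8) by (simp_all add: add.commute)
  have half_pi: "arccos t \<le> pi / 2" if "0 \<le> t" "t \<le> 1" for t
    using that by (subst arccos_le_iff_cos) auto
  have "arccos (y \<bullet> y') \<le> arccos (p \<bullet> p') + zeta2"
  proof (cases "0 \<le> ?X")
    case True
    then have "0 \<le> y \<bullet> y'" unfolding yy' using 1 2 by simp
    then show ?thesis using half_pi[of "y \<bullet> y'"] b arccos_lbound[OF bp] zeta2_bounds(1) by linarith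
  next
    case False
    let ?p = "extend p 0" and ?p' = "extend p' 0"
    have e: "norm ?p = 1" "norm ?p' = 1" using n by (simp_all add: norm_extend_eq_1_iff)
    have "1 * (c' * ?X) \<le> c * (c' * ?X)"
      using False c1 2(6) by (intro mult_right_mono_neg) (auto intro: mult_nonneg_nonpos)
    then have "?p \<bullet> y' \<le> y \<bullet> y'"
      unfolding yy' using 1 2 by (simp add: mult_ac add_increasing2)
    then have "arccos (y \<bullet> y') \<le> arccos (?p \<bullet> y')"
      using b inner_sphere_bounds[OF e(1) n(4)] by (intro arccos_le_arccos) auto
    also have "\<dots> \<le> arccos (?p \<bullet> ?p') + arccos (?p' \<bullet> y')"
      by (intro arccos_inner_triangle e n)
    also have "arccos (?p' \<bullet> y') \<le> pi / 2"
      using inner_sphere_bounds[OF e(2) n(4)] u' 2 by (intro half_pi) (auto simp: inner_commute)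
    finally show ?thesis using zeta2_bounds(1) by simp
  qed
  moreover have "arccos (p \<bullet> p') \<le> arccos (y \<bullet> y') + zeta2"
  proof -
    consider "?X \<le> 0" | "- (1 / 3) \<le> p \<bullet> p'" | "0 < ?X" "p \<bullet> p' < - (1 / 3)" by linarith
    then show ?thesis
    proof cases
      case 1
      have i4: "i < 4" using \<open>in_cell i p\<close> by (simp add: in_cell_def)
      have "c * c' * ?X \<le> 0" using 1 \<open>0 \<le> c\<close> \<open>0 \<le> c'\<close> by (intro mult_nonneg_nonpos) auto
      moreover have "s * s' \<le> s * 1" using \<open>0 \<le> s\<close> c1 by (intro mult_left_mono) auto
      ultimately have "y \<bullet> y' \<le> p \<bullet> tet i" unfolding yy' using \<open>s \<le> p \<bullet> tet i\<close> by linarith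
      then have "arccos (p \<bullet> tet i) \<le> arccos (y \<bullet> y')"
        using b inner_sphere_bounds[OF n(1) norm_tet[OF i4]] by (intro arccos_le_arccos) auto
      moreover have "arccos (p \<bullet> p') \<le> arccos (p \<bullet> tet i) + arccos (tet i \<bullet> p')"
        by (intro arccos_inner_triangle n norm_tet i4)
      moreover have "arccos (tet i \<bullet> p') \<le> zeta2"
        unfolding zeta2_def using i4 2 by (intro arccos_le_arccos) (auto simp: inner_tet_tet)
      ultimately show ?thesis by linarith
    next
      case 2
      then have "arccos (p \<bullet> p') \<le> zeta2"
        unfolding zeta2_def using bp by (intro arccos_le_arccos) auto
      then show ?thesis using arccos_lbound[OF b] by linarith
    next
      case 3
      define t where "t = - (p \<bullet> p')"
      have "y \<bullet> y' \<le> (t + sqrt 8 * sqrt (1 - t\<^sup>2)) / 3"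
        unfolding yy' using 1 2 3 n u' t_def by (intro band_cap_inner_le[of p x' p']) auto
      also have "\<dots> = cos (arccos (p \<bullet> p') - zeta2)"
        using bp
        by (simp add: cos_diff zeta2_def sin_arccos t_def power_divide real_sqrt_divide field_simps)
      finally have le: "y \<bullet> y' \<le> cos (arccos (p \<bullet> p') - zeta2)" .
      have "zeta2 \<le> arccos (p \<bullet> p')"
        unfolding zeta2_def using 3 bp by (intro arccos_le_arccos) auto
      then have "arccos (p \<bullet> p') - zeta2 = arccos (cos (arccos (p \<bullet> p') - zeta2))"
        using arccos_ubound[OF bp] zeta2_bounds by (intro arccos_cos[symmetric]) auto
      also have "\<dots> \<le> arccos (y \<bullet> y')"
        using le b by (intro arccos_le_arccos) auto
      finally show ?thesis by simp
    qed
  qed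
  ultimately show ?thesis by linarith
qed

lemma hemisphere_distortion:
  assumes "(p, y) \<in> band \<union> cap" "(p', y') \<in> band \<union> cap"
  shows "\<bar>arccos (p \<bullet> p') - arccos (y \<bullet> y')\<bar> \<le> zeta2"
  using assms band_band_distortion[of p y p' y'] cap_cap_distortion[of p y p' y']
    band_cap_distortion[of p y p' y'] band_cap_distortion[of p' y' p y]
  by (auto simp: inner_commute)

text \<open>
  Over the lower hemisphere the antipodal relation is used, which costs nothing by
  \<open>antipodal_distortion\<close>. The equator is paired with all of the two-dimensional sphere by the identity.
\<close>

theorem correspondence_S2_S3:
  obtains R where "correspondence S2 S3 R"
    "\<And>x y x' y'. (x, y) \<in> R \<Longrightarrow> (x', y') \<in> R \<Longrightarrow> \<bar>mdist S2 x x' - mdist S3 y y'\<bar> \<le> zeta2"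
proof
  let ?H = "band \<union> cap"
  define R where "R = ?H \<union> uminus ` ?H"
  have neg: "(a, b) \<in> ?H \<or> (- a, - b) \<in> ?H" if "(a, b) \<in> R" for a b
    using that by (auto simp: R_def uminus_prod_def)
  have R_unit: "norm x = 1 \<and> norm y = 1" if "(x, y) \<in> R" for x y
    using neg[OF that] band_cap_unit[of x y] band_cap_unit[of "- x" "- y"] by auto
  have fst: "x \<in> fst ` R" if x: "norm x = 1" for x
  proof -
    obtain i where i: "in_cell i x" using in_cell_exists by blast
    have "(x, extend (1 *\<^sub>R x) 0) \<in> band"
      unfolding band_def using x i cut_height_ge[OF cell_centre_ge[OF i x]]
      by (intro CollectI exI[of _ x] exI[of _ "1 :: real"] exI[of _ "0 :: real"] exI[of _ i]) simp
    then show ?thesis unfolding R_def by force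
  qed
  have upper: "extend v s \<in> snd ` ?H" if vs: "norm (extend v s) = 1" "0 \<le> s" for v s
  proof -
    have "\<exists>x. norm x = 1 \<and> v = norm v *\<^sub>R x"
    proof (cases "v = 0")
      case True
      then show ?thesis using vector_choose_size[of 1] by auto
    next
      case False
      then show ?thesis by (intro exI[of _ "v /\<^sub>R norm v"]) simp
    qed
    then obtain x where x: "norm x = 1" "v = norm v *\<^sub>R x" by blast
    obtain i where i: "in_cell i x" using in_cell_exists by blast
    have c: "(norm v)\<^sup>2 + s\<^sup>2 = 1" using vs by (simp add: norm_extend_eq_1_iff)
    have "(x, extend (norm v *\<^sub>R x) s) \<in> band \<or> (tet i, extend (norm v *\<^sub>R x) s) \<in> cap"
    proof (cases "s \<le> cut_height (x \<bullet> tet i)")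
      case True
      then have "(x, extend (norm v *\<^sub>R x) s) \<in> band"
        unfolding band_def using x i c vs(2)
        by (intro CollectI exI[of _ x] exI[of _ "norm v"] exI[of _ s] exI[of _ i]) simp
      then show ?thesis ..
    next
      case False
      then have "(tet i, extend (norm v *\<^sub>R x) s) \<in> cap"
        unfolding cap_def using x i c
        by (intro CollectI exI[of _ x] exI[of _ "norm v"] exI[of _ s] exI[of _ i]) simp
      then show ?thesis ..
    qed
    then show ?thesis unfolding x(2)[symmetric] by force
  qed
  have snd: "y \<in> snd ` R" if y: "norm y = 1" for y
  proof (rule extend_cases[of y])
    fix v s assume ys: "y = extend v s"
    show ?thesis
    proof (cases "0 \<le> s")
      case True
      then show ?thesis using upper[of v s] y ys unfolding R_def by auto
    next
      case False
      have "norm (extend (- v) (- s)) = 1" using y ys by (simp add: norm_extend_eq_1_iff)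
      then have "- y \<in> snd ` ?H"
        using False upper[of "- v" "- s"] ys by (simp add: uminus_extend)
      then obtain q where q: "q \<in> ?H" "- y = snd q" by blast
      then have "y = snd (- q)" by (metis minus_minus snd_uminus)
      then show ?thesis unfolding R_def using q(1) by blast
    qed
  qed
  show "correspondence S2 S3 R"
    unfolding correspondence_def using R_unit fst snd by (auto simp: image_iff) 
  fix x y x' y' assume R: "(x, y) \<in> R" "(x', y') \<in> R"
  have "\<bar>arccos (x \<bullet> x') - arccos (y \<bullet> y')\<bar> \<le> zeta2"
    using neg[OF R(1)] neg[OF R(2)] R_unit[OF R(1)] R_unit[OF R(2)]
      hemisphere_distortion[of x y x' y'] hemisphere_distortion[of "- x" "- y" x' y']
      hemisphere_distortion[of x y "- x'" "- y'"] hemisphere_distortion[of "- x" "- y" "- x'" "- y'"]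
      antipodal_distortion[of x x' y y']
    by auto
  then show "\<bar>mdist S2 x x' - mdist S3 y y'\<bar> \<le> zeta2"
    using R_unit[OF R(1)] R_unit[OF R(2)] by (simp add: mdist_geodesic_sphere)
qed

section \<open>Gluing metric spaces along a correspondence\<close>

text \<open>
  The distance between the two spaces when partners are joined by segments of length \<open>r\<close>: the infimum
  of the lengths of the paths that cross exactly one of these segments.
\<close>

definition gap :: "'a metric \<Rightarrow> 'b metric \<Rightarrow> ('a \<times> 'b) set \<Rightarrow> real \<Rightarrow> 'a \<Rightarrow> 'b \<Rightarrow> real" where
  "gap X Y R r x y = (INF p\<in>R. mdist X x (fst p) + r + mdist Y (snd p) y)"

fun glue_dist :: "'a metric \<Rightarrow> 'b metric \<Rightarrow> ('a \<times> 'b) set \<Rightarrow> real \<Rightarrow> 'a + 'b \<Rightarrow> 'a + 'b \<Rightarrow> real" where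
  "glue_dist X Y R r (Inl x) (Inl x') = mdist X x x'"
| "glue_dist X Y R r (Inr y) (Inr y') = mdist Y y y'"
| "glue_dist X Y R r (Inl x) (Inr y) = gap X Y R r x y"
| "glue_dist X Y R r (Inr y) (Inl x) = gap X Y R r x y"

lemma gap_le:
  assumes "(a, b) \<in> R"
  shows "gap X Y R r x y \<le> mdist X x a + r + mdist Y b y"
proof -
  have "bdd_below ((\<lambda>p. mdist X x (fst p) + r + mdist Y (snd p) y) ` R)"
    by (rule bdd_belowI2[of _ r]) simp
  from cINF_lower[OF this assms] show ?thesis by (simp add: gap_def)
qed

lemma gap_ge:
  assumes "R \<noteq> {}" "\<And>a b. (a, b) \<in> R \<Longrightarrow> t \<le> mdist X x a + r + mdist Y b y"
  shows "t \<le> gap X Y R r x y"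
  unfolding gap_def by (rule cINF_greatest) (use assms in auto)

text \<open>
  A shortcut through the other space uses two segments, hence costs \<open>2 * r\<close>, which makes up for the
  distortion. The remaining triangle inequalities hold for any relation.
\<close>

lemma Metric_space_glue:
  assumes R: "R \<noteq> {}" "R \<subseteq> mspace X \<times> mspace Y" and r: "0 < r"
    and dis: "\<And>x y x' y'. (x, y) \<in> R \<Longrightarrow> (x', y') \<in> R \<Longrightarrow> \<bar>mdist X x x' - mdist Y y y'\<bar> \<le> 2 * r"
  shows "Metric_space (mspace X <+> mspace Y) (glue_dist X Y R r)"
proof -
  have pos: "0 < gap X Y R r x y" for x y
    using gap_ge[OF R(1), of r X x r Y y] r by fastforce
  have RX: "a \<in> mspace X" "b \<in> mspace Y" if "(a, b) \<in> R" for a b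
    using R(2) that by auto
  have XXY: "gap X Y R r x y \<le> mdist X x x' + gap X Y R r x' y"
    if "x \<in> mspace X" "x' \<in> mspace X" for x x' y
  proof -
    have "gap X Y R r x y - mdist X x x' \<le> gap X Y R r x' y"
    proof (rule gap_ge[OF R(1)])
      fix a b assume ab: "(a, b) \<in> R"
      show "gap X Y R r x y - mdist X x x' \<le> mdist X x' a + r + mdist Y b y"
        using gap_le[OF ab, of X Y r x y] mdist_triangle[OF that RX(1)[OF ab]] by linarith
    qed
    then show ?thesis by linarith
  qed
  have XYY: "gap X Y R r x y \<le> gap X Y R r x y' + mdist Y y' y"
    if "y \<in> mspace Y" "y' \<in> mspace Y" for x y y'
  proof -
    have "gap X Y R r x y - mdist Y y' y \<le> gap X Y R r x y'"
    proof (rule gap_ge[OF R(1)])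
      fix a b assume ab: "(a, b) \<in> R"
      show "gap X Y R r x y - mdist Y y' y \<le> mdist X x a + r + mdist Y b y'"
        using gap_le[OF ab, of X Y r x y] mdist_triangle[OF RX(2)[OF ab] that(2,1)] by linarith
    qed
    then show ?thesis by linarith
  qed
  have XYX: "mdist X x x' \<le> gap X Y R r x y + gap X Y R r x' y"
    if "x \<in> mspace X" "x' \<in> mspace X" "y \<in> mspace Y" for x x' y
  proof -
    have "mdist X x x' - gap X Y R r x' y \<le> gap X Y R r x y"
    proof (rule gap_ge[OF R(1)])
      fix a b assume ab: "(a, b) \<in> R"
      have "mdist X x x' - (mdist X x a + r + mdist Y b y) \<le> gap X Y R r x' y"
      proof (rule gap_ge[OF R(1)])
        fix a' b' assume ab': "(a', b') \<in> R"
        show "mdist X x x' - (mdist X x a + r + mdist Y b y) \<le> mdist X x' a' + r + mdist Y b' y"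
          using dis[OF ab ab'] mdist_triangle[OF that(1) RX(1)[OF ab] that(2)]
            mdist_triangle[OF RX(1)[OF ab] RX(1)[OF ab'] that(2)]
            mdist_triangle[OF RX(2)[OF ab] that(3) RX(2)[OF ab']]
            mdist_commute[of X a' x'] mdist_commute[of Y y b'] by linarith
      qed
      then show "mdist X x x' - gap X Y R r x' y \<le> mdist X x a + r + mdist Y b y" by linarith
    qed
    then show ?thesis by linarith
  qed
  have YXY: "mdist Y y y' \<le> gap X Y R r x y + gap X Y R r x y'"
    if "y \<in> mspace Y" "y' \<in> mspace Y" "x \<in> mspace X" for x y y'
  proof -
    have "mdist Y y y' - gap X Y R r x y' \<le> gap X Y R r x y"
    proof (rule gap_ge[OF R(1)])
      fix a b assume ab: "(a, b) \<in> R"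
      have "mdist Y y y' - (mdist X x a + r + mdist Y b y) \<le> gap X Y R r x y'"
      proof (rule gap_ge[OF R(1)])
        fix a' b' assume ab': "(a', b') \<in> R"
        show "mdist Y y y' - (mdist X x a + r + mdist Y b y) \<le> mdist X x a' + r + mdist Y b' y'"
          using dis[OF ab ab'] mdist_triangle[OF that(1) RX(2)[OF ab] that(2)]
            mdist_triangle[OF RX(2)[OF ab] RX(2)[OF ab'] that(2)]
            mdist_triangle[OF RX(1)[OF ab] that(3) RX(1)[OF ab']]
            mdist_commute[of X a x] mdist_commute[of Y y b] by linarith
      qed
      then show "mdist Y y y' - gap X Y R r x y' \<le> mdist X x a + r + mdist Y b y" by linarith
    qed
    then show ?thesis by linarith
  qed
  have XXY': "gap X Y R r x y \<le> gap X Y R r x' y + mdist X x' x"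
    if "x \<in> mspace X" "x' \<in> mspace X" for x x' y
    using XXY[OF that] by (simp add: mdist_commute[of X x' x] add.commute)
  have XYY': "gap X Y R r x y \<le> mdist Y y y' + gap X Y R r x y'"
    if "y \<in> mspace Y" "y' \<in> mspace Y" for x y y'
    using XYY[OF that] by (simp add: mdist_commute[of Y y' y] add.commute)
  show ?thesis
  proof
    fix u v :: "'a + 'b"
    show "0 \<le> glue_dist X Y R r u v"
      by (cases u; cases v) (auto intro: less_imp_le pos)
    show "glue_dist X Y R r u v = glue_dist X Y R r v u"
      by (cases u; cases v) (auto simp: mdist_commute)
  next
    fix u v assume "u \<in> mspace X <+> mspace Y" "v \<in> mspace X <+> mspace Y"
    then show "(glue_dist X Y R r u v = 0) = (u = v)"
      using pos by (auto simp: less_imp_neq[symmetric])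
  next
    fix u v w
    assume "u \<in> mspace X <+> mspace Y" "v \<in> mspace X <+> mspace Y" "w \<in> mspace X <+> mspace Y"
    then show "glue_dist X Y R r u w \<le> glue_dist X Y R r u v + glue_dist X Y R r v w"
      using XXY XXY' XYY XYY' XYX YXY
      by (elim PlusE) (simp_all add: mdist_triangle)
  qed
qed

theorem correspondence_gluing:
  fixes X :: "'a metric" and Y :: "'b metric"
  assumes R: "correspondence X Y R" and ne: "mspace X \<noteq> {}" and r: "0 < r"
    and dis: "\<And>x y x' y'. (x, y) \<in> R \<Longrightarrow> (x', y') \<in> R \<Longrightarrow> \<bar>mdist X x x' - mdist Y y y'\<bar> \<le> 2 * r"
  obtains Z :: "('a + 'b) metric" and f g where
    "isometric_embedding X Z f" "isometric_embedding Y Z g"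
    "hausdorff_distance Z (f ` mspace X) (g ` mspace Y) \<le> r"
proof
  have sub: "R \<subseteq> mspace X \<times> mspace Y" and projs: "fst ` R = mspace X" "snd ` R = mspace Y"
    using R by (auto simp: correspondence_def)
  have Rne: "R \<noteq> {}" and Yne: "mspace Y \<noteq> {}" using ne projs by auto
  have M: "Metric_space (mspace X <+> mspace Y) (glue_dist X Y R r)"
    using Rne sub r dis by (rule Metric_space_glue)
  define Z where "Z = metric (mspace X <+> mspace Y, glue_dist X Y R r)"
  have Z: "mspace Z = mspace X <+> mspace Y" "mdist Z = glue_dist X Y R r"
    unfolding Z_def using Metric_space.mspace_metric[OF M] Metric_space.mdist_metric[OF M] .
  show "isometric_embedding X Z Inl" "isometric_embedding Y Z Inr"
    by (auto simp: isometric_embedding_def Z)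
  have gap_R: "gap X Y R r a b \<le> r" if "(a, b) \<in> R" for a b
  proof -
    have "a \<in> mspace X" "b \<in> mspace Y" using sub that by auto
    then have "mdist X a a = 0" "mdist Y b b = 0" by simp_all
    then show ?thesis using gap_le[OF that, of X Y r a b] by simp
  qed
  have below: "bdd_below (gap X Y R r x ` B)" "bdd_below ((\<lambda>x. gap X Y R r x y) ` A)" for x y A B
    using gap_ge[OF Rne, of 0] r by (auto intro!: bdd_belowI2[of _ 0])
  have "(INF y\<in>mspace Y. gap X Y R r x y) \<le> r" if x: "x \<in> mspace X" for x
  proof -
    obtain y where "(x, y) \<in> R" using x projs(1) by force
    then show ?thesis using sub by (intro cINF_lower2[OF below(1), of y] gap_R) auto
  qed
  moreover have "(INF x\<in>mspace X. gap X Y R r x y) \<le> r" if y: "y \<in> mspace Y" for y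
  proof -
    obtain x where "(x, y) \<in> R" using y projs(2) by force
    then show ?thesis using sub by (intro cINF_lower2[OF below(2), of x] gap_R) auto
  qed
  ultimately show "hausdorff_distance Z (Inl ` mspace X) (Inr ` mspace Y) \<le> r"
    unfolding hausdorff_distance_def
    by (auto simp: image_image Z intro!: cSUP_least ne Yne)
qed

section \<open>The distance between the two spheres\<close>

theorem proposition1p19:
  shows "(\<exists>R. correspondence S2 S3 R \<and> distortion S2 S3 R \<le> zeta2) \<and>
         gromov_hausdorff S2 S3 = 1 / 2 * zeta2"
proof
  obtain R where R: "correspondence S2 S3 R"
    and dis: "\<And>x y x' y'. (x, y) \<in> R \<Longrightarrow> (x', y') \<in> R \<Longrightarrow> \<bar>mdist S2 x x' - mdist S3 y y'\<bar> \<le> zeta2"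
    by (rule correspondence_S2_S3) blast
  have ne: "mspace S2 \<noteq> {}" by simp
  have "R \<noteq> {}" using R ne unfolding correspondence_def by (metis image_empty)
  then obtain a b where "(a, b) \<in> R" by (metis ex_in_conv surj_pair)
  then have "{\<bar>mdist S2 x x' - mdist S3 y y'\<bar> | x y x' y'. (x, y) \<in> R \<and> (x', y') \<in> R} \<noteq> {}"
    by blast
  then have "distortion S2 S3 R \<le> zeta2"
    unfolding distortion_def by (rule cSup_least) (use dis in blast)
  then show "\<exists>R. correspondence S2 S3 R \<and> distortion S2 S3 R \<le> zeta2"
    using R by blast
  have "0 < zeta2 / 2" using zeta2_bounds(1) pi_gt_zero by linarith
  moreover have "\<bar>mdist S2 x x' - mdist S3 y y'\<bar> \<le> 2 * (zeta2 / 2)"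
    if "(x, y) \<in> R" "(x', y') \<in> R" for x y x' y'
    using dis[OF that] by simp
  ultimately obtain Z :: "(real ^ 3 + real ^ 4) metric" and f g where
    Z: "isometric_embedding S2 Z f" "isometric_embedding S3 Z g"
      "hausdorff_distance Z (f ` mspace S2) (g ` mspace S3) \<le> zeta2 / 2"
    using correspondence_gluing[OF R ne] by metis
  have "gromov_hausdorff S2 S3 = zeta2 / 2"
    unfolding gromov_hausdorff_def
  proof (rule cInf_eq_minimum)
    have "hausdorff_distance Z (f ` mspace S2) (g ` mspace S3) = zeta2 / 2"
      using Z hausdorff_distance_spheres_ge[OF Z(1,2)] by simp
    then show "zeta2 / 2 \<in> {hausdorff_distance Z (f ` mspace S2) (g ` mspace S3) |
        (Z :: (real ^ 3 + real ^ 4) metric) f g.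
          isometric_embedding S2 Z f \<and> isometric_embedding S3 Z g}"
      using Z(1,2) by (metis (mono_tags, lifting) mem_Collect_eq)
  qed (use hausdorff_distance_spheres_ge in blast)
  then show "gromov_hausdorff S2 S3 = 1 / 2 * zeta2" by simp
qed

end
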